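(* Let $q\in(-1,1)\setminus\{0\}$ and let $\mathbb{G}_q=SU_q(2)$. Then the discrete quantum group $\widehat{\mathbb{G}_q}$ is not $C^*$-unique; that is, the $^*$-algebra $\mathrm{Pol}(\mathbb{G}_q)$ does not have a unique pre-$C^*$-norm.
   Context: $\mathrm{Pol}(\mathbb{G}_q)=\mathrm{Pol}(SU_q(2))$ is the unital $^*$-algebra generated by elements $\alpha,\gamma$ subject to the relations $$\gamma^*\gamma=\gamma\gamma^*,\quad q\gamma^*\alpha=\alpha\gamma^*,\quad q\gamma\alpha=\alpha\gamma,\quad \alpha^*\alpha+\gamma^*\gamma=1,\quad \alpha\alpha^*+q^2\gamma\gamma^*=1,$$ with comultiplication determined by $\Delta(\alpha)=\alpha\otimes\alpha-q\gamma^*\otimes\gamma$ and $\Delta(\gamma)=\gamma\otimes\alpha+\alpha^*\otimes\gamma$. For a compact quantum group $\mathbb{G}$ with dual discrete quantum group $\widehat{\mathbb{G}}$, the quantum group ring is $\mathbb{C}[\widehat{\mathbb{G}}]=\mathrm{Pol}(\mathbb{G})$. A pre-$C^*$-norm on a unital $^*$-algebra is a norm such that the completion is a $C^*$-algebra. A discrete quantum group $\mathbb{\Gamma}$ is called $C^*$-unique if $\mathbb{C}[\mathbb{\Gamma}]$ has a unique pre-$C^*$-norm. *)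

theory Defs
  imports
    Complex_Main
    "HOL-Library.Poly_Mapping"
    "HOL-Algebra.QuotRing"
    "HOL-Algebra.Module"
    "HOL-Algebra.Algebraic_Closure_Type"
begin

section \<open>Unital complex \<open>*\<close>-algebras\<close>

record 'a star_algebra = "(complex, 'a) module" +
  star :: "'a \<Rightarrow> 'a"

text \<open>\<^locale>\<open>algebra\<close> of HOL-Algebra is restricted to commutative algebras.\<close>

locale star_algebra =
  ring A + Mod: module "ring_of_type_algebra :: complex ring" A for A :: "'a star_algebra" (structure) +
  assumes smult_mult_left:
      "\<lbrakk>x \<in> carrier A; y \<in> carrier A\<rbrakk> \<Longrightarrow> (c \<odot> x) \<otimes> y = c \<odot> (x \<otimes> y)"
    and smult_mult_right:
      "\<lbrakk>x \<in> carrier A; y \<in> carrier A\<rbrakk> \<Longrightarrow> x \<otimes> (c \<odot> y) = c \<odot> (x \<otimes> y)"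
    and star_closed: "x \<in> carrier A \<Longrightarrow> star A x \<in> carrier A"
    and star_star: "x \<in> carrier A \<Longrightarrow> star A (star A x) = x"
    and star_add:
      "\<lbrakk>x \<in> carrier A; y \<in> carrier A\<rbrakk> \<Longrightarrow> star A (x \<oplus> y) = star A x \<oplus> star A y"
    and star_smult: "x \<in> carrier A \<Longrightarrow> star A (c \<odot> x) = cnj c \<odot> star A x"
    and star_mult:
      "\<lbrakk>x \<in> carrier A; y \<in> carrier A\<rbrakk> \<Longrightarrow> star A (x \<otimes> y) = star A y \<otimes> star A x"

definition star_hom :: "'a star_algebra \<Rightarrow> 'b star_algebra \<Rightarrow> ('a \<Rightarrow> 'b) set" where
  "star_hom A B = {f \<in> ring_hom A B.
     (\<forall>c. \<forall>x\<in>carrier A. f (c \<odot>\<^bsub>A\<^esub> x) = c \<odot>\<^bsub>B\<^esub> f x) \<and>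
     (\<forall>x\<in>carrier A. f (star A x) = star B (f x))}"


section \<open>Pre-\<open>C\<^sup>*\<close>-norms and \<open>C\<^sup>*\<close>-uniqueness\<close>

definition norm_on :: "'a star_algebra \<Rightarrow> ('a \<Rightarrow> real) \<Rightarrow> bool" where
  "norm_on A N \<longleftrightarrow>
     (\<forall>x\<in>carrier A. 0 \<le> N x) \<and>
     (\<forall>x\<in>carrier A. N x = 0 \<longleftrightarrow> x = \<zero>\<^bsub>A\<^esub>) \<and>
     (\<forall>c. \<forall>x\<in>carrier A. N (c \<odot>\<^bsub>A\<^esub> x) = cmod c * N x) \<and>
     (\<forall>x\<in>carrier A. \<forall>y\<in>carrier A. N (x \<oplus>\<^bsub>A\<^esub> y) \<le> N x + N y)"

definition complete_norm_on :: "'a star_algebra \<Rightarrow> ('a \<Rightarrow> real) \<Rightarrow> bool" where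
  "complete_norm_on A N \<longleftrightarrow> norm_on A N \<and>
     (\<forall>u :: nat \<Rightarrow> 'a.
        (\<forall>n. u n \<in> carrier A) \<longrightarrow>
        (\<forall>e>0. \<exists>n0. \<forall>m\<ge>n0. \<forall>n\<ge>n0. N (u m \<ominus>\<^bsub>A\<^esub> u n) < e) \<longrightarrow>
        (\<exists>x\<in>carrier A. (\<lambda>n. N (u n \<ominus>\<^bsub>A\<^esub> x)) \<longlonglongrightarrow> 0))"

locale cstar_algebra = star_algebra A
  for A :: "'a star_algebra" (structure) and N :: "'a \<Rightarrow> real" +
  assumes complete_norm: "complete_norm_on A N"
    and submultiplicative:
      "\<lbrakk>x \<in> carrier A; y \<in> carrier A\<rbrakk> \<Longrightarrow> N (x \<otimes> y) \<le> N x * N y"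
    and cstar_identity: "x \<in> carrier A \<Longrightarrow> N (star A x \<otimes> x) = (N x)\<^sup>2"

text \<open>The completion of \<open>(A, N)\<close> is a complete normed space containing \<open>A\<close> isometrically
  and densely. Being a \<open>C\<^sup>*\<close>-algebra, it carries \<open>*\<close>-algebra operations which extend
  those of \<open>A\<close>. Completions are unique up to isometric isomorphism and can be realised
  as a set of equivalence classes of Cauchy sequences in \<open>A\<close>, so fixing
  the element type \<open>(nat \<Rightarrow> 'a) set\<close> of \<open>B\<close> is no restriction.\<close>

definition pre_cstar_norm :: "'a star_algebra \<Rightarrow> ('a \<Rightarrow> real) \<Rightarrow> bool" where
  "pre_cstar_norm A N \<longleftrightarrow> norm_on A N \<and>
     (\<exists>(B :: (nat \<Rightarrow> 'a) set star_algebra) M. \<exists>\<iota> \<in> star_hom A B.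
        cstar_algebra B M \<and>
        (\<forall>x\<in>carrier A. M (\<iota> x) = N x) \<and>
        (\<forall>y\<in>carrier B. \<forall>e>0. \<exists>x\<in>carrier A. M (y \<ominus>\<^bsub>B\<^esub> \<iota> x) < e))"

text \<open>A discrete quantum group is \<open>C\<^sup>*\<close>-unique iff its quantum group ring \<open>A\<close>, the algebra
  \<open>Pol\<close> of the dual compact quantum group, satisfies the following property. The
  comultiplication does not enter. Norms are compared on the carrier only, since their
  values outside it are irrelevant.\<close>

definition cstar_unique :: "'a star_algebra \<Rightarrow> bool" where
  "cstar_unique A \<longleftrightarrow>
     (\<exists>N. pre_cstar_norm A N \<and>
        (\<forall>N'. pre_cstar_norm A N' \<longrightarrow> (\<forall>x\<in>carrier A. N' x = N x)))"


section \<open>Unital \<open>*\<close>-algebras given by generators and relations\<close>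

text \<open>The free unital \<open>*\<close>-algebra on \<open>'g\<close> is the monoid algebra over \<open>\<complex>\<close> of the free monoid
  on the letters \<open>g\<close>, \<open>g\<^sup>*\<close>. The multiplication of \<^theory>\<open>HOL-Library.Poly_Mapping\<close>
  is convolution over an additively written monoid, so concatenation of words is \<open>+\<close>.\<close>

datatype 'g letter = Gen 'g | Adj 'g

datatype 'g word = Word (letters: "'g letter list")

instantiation word :: (type) monoid_add
begin

definition zero_word :: "'a word" where "0 = Word []"

definition plus_word :: "'a word \<Rightarrow> 'a word \<Rightarrow> 'a word" where
  "v + w = Word (letters v @ letters w)"

instance
  by standard (simp_all add: zero_word_def plus_word_def)

end

fun letter_star :: "'g letter \<Rightarrow> 'g letter" where
  "letter_star (Gen g) = Adj g"
| "letter_star (Adj g) = Gen g"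

definition word_star :: "'g word \<Rightarrow> 'g word" where
  "word_star w = Word (rev (map letter_star (letters w)))"

text \<open>As \<^const>\<open>word_star\<close> is an involution, the coefficient of \<open>p\<^sup>*\<close> at \<open>w\<close> is the conjugate of
  the coefficient of \<open>p\<close> at \<open>w\<^sup>*\<close>.\<close>

definition free_star_algebra :: "('g word \<Rightarrow>\<^sub>0 complex) star_algebra" where
  "free_star_algebra =
     \<lparr>carrier = UNIV, monoid.mult = (*), one = 1, zero = 0, add = (+),
      module.smult = (\<lambda>c. Poly_Mapping.map ((*) c)),
      star = (\<lambda>p. Poly_Mapping.map cnj (Poly_Mapping.map_key word_star p))\<rparr>"

definition generated_star_ideal :: "'a star_algebra \<Rightarrow> 'a set \<Rightarrow> 'a set" where
  "generated_star_ideal A S = \<Inter>{I. ideal I A \<and> star A ` I \<subseteq> I \<and> S \<subseteq> I}"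

definition quotient_star_algebra :: "'a star_algebra \<Rightarrow> 'a set \<Rightarrow> 'a set star_algebra" where
  "quotient_star_algebra A I =
     \<lparr>carrier = carrier (A Quot I), monoid.mult = monoid.mult (A Quot I), one = one (A Quot I),
      zero = zero (A Quot I), add = add (A Quot I),
      module.smult = (\<lambda>c P. \<Union>p\<in>P. I +>\<^bsub>A\<^esub> (c \<odot>\<^bsub>A\<^esub> p)),
      star = (\<lambda>P. \<Union>p\<in>P. I +>\<^bsub>A\<^esub> star A p)\<rparr>"

text \<open>A relation \<open>l = r\<close> is given by the element \<open>l - r\<close>.\<close>

definition presented_star_algebra ::
    "('g word \<Rightarrow>\<^sub>0 complex) set \<Rightarrow> ('g word \<Rightarrow>\<^sub>0 complex) set star_algebra" where
  "presented_star_algebra R =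
     quotient_star_algebra free_star_algebra (generated_star_ideal free_star_algebra R)"


section \<open>The algebra \<open>Pol(SU\<^sub>q(2))\<close>\<close>

datatype suq2_generator = Alpha | Gamma

definition suq2_relations :: "real \<Rightarrow> (suq2_generator word \<Rightarrow>\<^sub>0 complex) set" where
  "suq2_relations q =
     (let x = (\<lambda>l. Poly_Mapping.single (Word [l]) 1);
          a = x (Gen Alpha); a' = x (Adj Alpha);
          c = x (Gen Gamma); c' = x (Adj Gamma);
          k = (\<lambda>t. Poly_Mapping.single 0 (complex_of_real t))
      in {c' * c - c * c',
          k q * c' * a - a * c',
          k q * c * a - a * c,
          a' * a + c' * c - 1,
          a * a' + k (q\<^sup>2) * c * c' - 1})"

definition Pol_SUq2 ::
    "real \<Rightarrow> (suq2_generator word \<Rightarrow>\<^sub>0 complex) set star_algebra" where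
  "Pol_SUq2 q = presented_star_algebra (suq2_relations q)"

end

theory Submission
  imports
    Defs
    "HOL-Analysis.Elementary_Normed_Spaces"
    "HOL-Analysis.Inner_Product"
    "HOL-Analysis.Operator_Norm"
    "HOL-Computational_Algebra.Polynomial"
begin

text \<open>
  For every point \<open>s\<close> of the unit circle, \<open>Pol(SU\<^sub>q(2))\<close> acts on the finitely supported functions
  on \<open>\<nat>\<close> by \<open>\<gamma> e\<^sub>j = s q\<^sup>j e\<^sub>j\<close> and \<open>\<alpha> e\<^sub>j = (1 - q\<^bsup>2j\<^esup>)\<^bsup>1/2\<^esup> e\<^bsub>j-1\<^esub>\<close>. For a sequence \<open>\<sigma>\<close> of
  distinct points of the circle let \<open>\<pi>\<^sub>\<sigma>\<close> be the direct sum of the representations with parameters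
  \<open>\<sigma>\<^sub>0, \<sigma>\<^sub>1, \<dots>\<close>. The operator norm of \<open>\<pi>\<^sub>\<sigma>(x)\<close> depends on the chosen points, but \<open>\<pi>\<^sub>\<sigma>\<close> is always
  faithful: infinitely many points of the circle suffice to separate polynomials. Hence different
  choices of \<open>\<sigma>\<close> may lead to different pre-\<open>C\<^sup>*\<close>-norms.

  The element \<open>1 + \<gamma>\<close> acts diagonally with entries \<open>1 + \<sigma>\<^sub>i q\<^sup>j\<close>. If \<open>\<sigma>\<^sub>0 = 1\<close>, then its norm is at
  least 2. If all \<open>\<sigma>\<^sub>i\<close> have a nonpositive real part, then the entries with \<open>j = 0\<close> have modulus
  at most \<open>\<surd>2\<close> and the other ones at most \<open>1 + \<bar>q\<bar> < 2\<close>, so that the norm is less than 2. The points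
  of an arc in the right half plane and their negatives are two sequences of these kinds, and
  therefore there is no unique pre-\<open>C\<^sup>*\<close>-norm.

  Faithfulness (\<open>rep_faithful\<close>) rests on a normal form: with \<open>\<alpha>\<^bsup>-k\<^esup>\<close> read as \<open>(\<alpha>\<^sup>*)\<^sup>k\<close>, the
  elements \<open>\<alpha>\<^sup>k \<gamma>\<^sup>m (\<gamma>\<^sup>*)\<^sup>n\<close> span the algebra (\<open>normal_form\<close>). Such an element maps the basis vector
  at \<open>(i, j)\<close> to a multiple of the one at \<open>(i, j - k)\<close>, so different \<open>k\<close> do not interfere with
  each other, and for fixed \<open>k\<close> a vanishing combination means that a polynomial in \<open>z\<close> and \<open>z\<^sup>*\<close>
  vanishes at all points \<open>\<sigma>\<^sub>i q\<^sup>j\<close> with large \<open>j\<close>. Separating first the powers of \<open>q\<^sup>j\<close> and then those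
  of \<open>\<sigma>\<^sub>i\<close> shows that it is zero (\<open>monomials_independent\<close>).

  Two general facts turn such a representation into a pre-\<open>C\<^sup>*\<close>-norm. The \<open>C\<^sup>*\<close>-identity of
  operator norms follows from the Cauchy-Schwarz inequality and the existence of adjoints, so it
  already holds on the finitely supported functions (\<open>onorm_adjoint_compose\<close>). And a \<open>*\<close>-algebra
  whose norm is submultiplicative and satisfies the \<open>C\<^sup>*\<close>-identity has a completion which is a \<open>C\<^sup>*\<close>-algebra: the Cauchy sequences
  modulo the null sequences (\<open>cstar_normed.pre_cstar_norm\<close>).
\<close>

section \<open>Quotients by \<open>*\<close>-ideals\<close>

lemma carrier_ring_of_type_algebra [simp]: "carrier (ring_of_type_algebra :: complex ring) = UNIV"
  by (simp add: ring_of_type_algebra_def)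

lemma ring_of_type_algebra_simps [simp]:
  "add (ring_of_type_algebra :: complex ring) = (+)"
  "monoid.mult (ring_of_type_algebra :: complex ring) = (*)"
  "one (ring_of_type_algebra :: complex ring) = 1"
  "zero (ring_of_type_algebra :: complex ring) = 0"
  by (simp_all add: ring_of_type_algebra_def)

lemma star_algebraI:
  fixes A :: "'a star_algebra" (structure)
  assumes "ring A"
    and "\<And>c x. x \<in> carrier A \<Longrightarrow> c \<odot> x \<in> carrier A"
    and "\<And>c d x. x \<in> carrier A \<Longrightarrow> (c + d) \<odot> x = c \<odot> x \<oplus> d \<odot> x"
    and "\<And>c x y. \<lbrakk>x \<in> carrier A; y \<in> carrier A\<rbrakk> \<Longrightarrow> c \<odot> (x \<oplus> y) = c \<odot> x \<oplus> c \<odot> y"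
    and "\<And>c d x. x \<in> carrier A \<Longrightarrow> (c * d) \<odot> x = c \<odot> (d \<odot> x)"
    and "\<And>x. x \<in> carrier A \<Longrightarrow> 1 \<odot> x = x"
    and "\<And>c x y. \<lbrakk>x \<in> carrier A; y \<in> carrier A\<rbrakk> \<Longrightarrow> (c \<odot> x) \<otimes> y = c \<odot> (x \<otimes> y)"
    and "\<And>c x y. \<lbrakk>x \<in> carrier A; y \<in> carrier A\<rbrakk> \<Longrightarrow> x \<otimes> (c \<odot> y) = c \<odot> (x \<otimes> y)"
    and "\<And>x. x \<in> carrier A \<Longrightarrow> star A x \<in> carrier A"
    and "\<And>x. x \<in> carrier A \<Longrightarrow> star A (star A x) = x"
    and "\<And>x y. \<lbrakk>x \<in> carrier A; y \<in> carrier A\<rbrakk> \<Longrightarrow> star A (x \<oplus> y) = star A x \<oplus> star A y"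
    and "\<And>c x. x \<in> carrier A \<Longrightarrow> star A (c \<odot> x) = cnj c \<odot> star A x"
    and "\<And>x y. \<lbrakk>x \<in> carrier A; y \<in> carrier A\<rbrakk> \<Longrightarrow> star A (x \<otimes> y) = star A y \<otimes> star A x"
  shows "star_algebra A"
proof -
  interpret ring A by fact
  have "module (ring_of_type_algebra :: complex ring) A"
    by (rule moduleI) (use assms in \<open>auto simp: cring_from_type_algebra is_abelian_group\<close>)
  then show ?thesis
    using assms by (intro star_algebra.intro star_algebra_axioms.intro) auto
qed

context star_algebra
begin

lemma
  assumes "x \<in> carrier A"
  shows scale_closed [simp, intro]: "c \<odot> x \<in> carrier A"
    and scale_assoc: "(c * d) \<odot> x = c \<odot> (d \<odot> x)"
    and scale_one: "1 \<odot> x = x"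
    and scale_add_left: "(c + d) \<odot> x = c \<odot> x \<oplus> d \<odot> x"
  using Mod.smult_closed[of c x] Mod.smult_assoc1[of c d x] Mod.smult_one[of x]
    Mod.smult_l_distr[of c d x] assms by simp_all

lemma scale_add_right:
  "\<lbrakk>x \<in> carrier A; y \<in> carrier A\<rbrakk> \<Longrightarrow> c \<odot> (x \<oplus> y) = c \<odot> x \<oplus> c \<odot> y"
  using Mod.smult_r_distr[of c x y] by simp

lemma uminus_eq_scale:
  assumes "x \<in> carrier A" shows "\<ominus> x = (- 1) \<odot> x"
proof -
  have "(-1) \<odot> x \<oplus> x = (-1 + 1) \<odot> x"
    using assms by (simp only: scale_add_left scale_one)
  also have "\<dots> = \<zero>"
    using Mod.smult_l_null[of x] assms by simp
  finally show ?thesis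
    using assms by (simp add: minus_equality)
qed

lemma scale_minus_right:
  assumes "x \<in> carrier A" "y \<in> carrier A"
  shows "c \<odot> (x \<ominus> y) = c \<odot> x \<ominus> c \<odot> y"
  using assms
  by (simp add: a_minus_def uminus_eq_scale scale_add_right flip: scale_assoc)

lemma star_minus:
  assumes "x \<in> carrier A" "y \<in> carrier A"
  shows "star A (x \<ominus> y) = star A x \<ominus> star A y"
  using assms
  by (simp add: a_minus_def uminus_eq_scale star_add star_smult star_closed)

text \<open>Ideals are closed under scalars because \<open>c x = (c 1) x\<close> in a unital algebra.\<close>

lemma ideal_scale_closed:
  assumes "ideal I A" "x \<in> I" shows "c \<odot> x \<in> I"
proof -
  interpret I: ideal I A by fact
  have x: "x \<in> carrier A" using assms(2) by (rule I.Icarr)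
  have "c \<odot> x = (c \<odot> \<one>) \<otimes> x"
    using x by (simp add: smult_mult_left)
  then show ?thesis
    using assms(2) by (simp add: I.I_l_closed)
qed

end

text \<open>Scalar multiplication and \<open>*\<close> on the quotient are defined as unions over all representatives.
  When the operation respects the congruence, all sets in the union coincide.\<close>

lemma (in ideal) UN_coset_eq:
  assumes f: "\<And>x. x \<in> carrier R \<Longrightarrow> f x \<in> carrier R"
    and compat: "\<And>x y. \<lbrakk>x \<in> carrier R; y \<in> carrier R; x \<ominus> y \<in> I\<rbrakk> \<Longrightarrow> f x \<ominus> f y \<in> I"
    and a: "a \<in> carrier R"
  shows "(\<Union>p\<in>I +> a. I +> f p) = I +> f a"
proof -
  have "I +> f p = I +> f a" if "p \<in> I +> a" for p
  proof -
    have p: "p \<in> carrier R"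
      using that a a_r_coset_subset_G[OF a_subset a] by auto
    have "p \<ominus> a \<in> I"
      using that p a a_rcos_module_minus[OF ring_axioms] by blast
    then have "f p \<ominus> f a \<in> I" using compat p a by blast
    then show ?thesis
      using quotient_eq_iff_same_a_r_cos[OF is_ideal] f p a by blast
  qed
  moreover have "a \<in> I +> a" using a by (rule a_rcos_self)
  ultimately show ?thesis by blast
qed

locale star_ideal = star_algebra A + ideal I A for A :: "'a star_algebra" (structure) and I +
  assumes star_mem: "x \<in> I \<Longrightarrow> star A x \<in> I"
begin

abbreviation Q :: "'a set star_algebra" where "Q \<equiv> quotient_star_algebra A I"

lemma carrier_Q: "carrier Q = (+>) I ` carrier A"
  by (auto simp: quotient_star_algebra_def FactRing_def A_RCOSETS_def')

lemma coset_in_carrier [simp]: "x \<in> carrier A \<Longrightarrow> I +> x \<in> carrier Q"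
  by (simp add: carrier_Q)

lemma add_Q [simp]:
  "\<lbrakk>x \<in> carrier A; y \<in> carrier A\<rbrakk> \<Longrightarrow> (I +> x) \<oplus>\<^bsub>Q\<^esub> (I +> y) = I +> (x \<oplus> y)"
  by (simp add: quotient_star_algebra_def FactRing_def a_rcos_sum)

lemma mult_Q [simp]:
  "\<lbrakk>x \<in> carrier A; y \<in> carrier A\<rbrakk> \<Longrightarrow> (I +> x) \<otimes>\<^bsub>Q\<^esub> (I +> y) = I +> (x \<otimes> y)"
  by (simp add: quotient_star_algebra_def FactRing_def rcoset_mult_add)

lemma one_Q: "\<one>\<^bsub>Q\<^esub> = I +> \<one>"
  by (simp add: quotient_star_algebra_def FactRing_def)

lemma zero_Q: "\<zero>\<^bsub>Q\<^esub> = I +> \<zero>"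
  by (simp add: quotient_star_algebra_def FactRing_def a_rcos_const)

lemma scale_Q [simp]:
  assumes "x \<in> carrier A" shows "c \<odot>\<^bsub>Q\<^esub> (I +> x) = I +> c \<odot> x"
  unfolding quotient_star_algebra_def module.simps
  using assms
  by (intro UN_coset_eq) (auto simp: ideal_scale_closed[OF is_ideal] simp flip: scale_minus_right)

lemma star_Q [simp]:
  assumes "x \<in> carrier A" shows "star Q (I +> x) = I +> star A x"
  unfolding quotient_star_algebra_def star_algebra.simps
  using assms
  by (intro UN_coset_eq) (auto simp: star_mem star_closed simp flip: star_minus)

lemma coset_eq_iff:
  "\<lbrakk>x \<in> carrier A; y \<in> carrier A\<rbrakk> \<Longrightarrow> I +> x = I +> y \<longleftrightarrow> x \<ominus> y \<in> I"
  using quotient_eq_iff_same_a_r_cos[OF is_ideal] by blast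

lemma star_algebra_Q: "star_algebra Q"
proof (rule star_algebraI)
  show "ring Q"
  proof (intro ringI abelian_groupI monoidI)
    fix P assume "P \<in> carrier Q"
    then obtain x where "x \<in> carrier A" "P = I +> x" by (auto simp: carrier_Q)
    then show "\<exists>R\<in>carrier Q. R \<oplus>\<^bsub>Q\<^esub> P = \<zero>\<^bsub>Q\<^esub>"
      by (intro bexI[of _ "I +> (\<ominus> x)"]) (auto simp: zero_Q l_neg)
  qed (auto simp: carrier_Q zero_Q one_Q a_ac m_assoc l_distr r_distr)
qed (auto simp: carrier_Q scale_assoc scale_one scale_add_left scale_add_right smult_mult_left
    smult_mult_right star_closed star_star star_add star_smult star_mult)

lemma minus_Q [simp]:
  assumes "x \<in> carrier A" "y \<in> carrier A"
  shows "(I +> x) \<ominus>\<^bsub>Q\<^esub> (I +> y) = I +> (x \<ominus> y)"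
proof -
  interpret Q: star_algebra Q by (rule star_algebra_Q)
  show ?thesis
    using assms by (simp add: a_minus_def uminus_eq_scale Q.uminus_eq_scale)
qed

end

section \<open>Completion of an algebra with a \<open>C\<^sup>*\<close>-norm\<close>

locale cstar_normed = star_algebra A
  for A :: "'a star_algebra" (structure) and N :: "'a \<Rightarrow> real" +
  assumes norm_on: "norm_on A N"
    and submult: "\<lbrakk>x \<in> carrier A; y \<in> carrier A\<rbrakk> \<Longrightarrow> N (x \<otimes> y) \<le> N x * N y"
    and cstar_id: "x \<in> carrier A \<Longrightarrow> N (star A x \<otimes> x) = (N x)\<^sup>2"
begin

lemma
  assumes "x \<in> carrier A"
  shows N_nonneg: "0 \<le> N x"
    and N_eq_0_iff: "N x = 0 \<longleftrightarrow> x = \<zero>"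
    and N_scale: "N (c \<odot> x) = cmod c * N x"
  using norm_on assms by (simp_all add: norm_on_def)

lemma N_add: "\<lbrakk>x \<in> carrier A; y \<in> carrier A\<rbrakk> \<Longrightarrow> N (x \<oplus> y) \<le> N x + N y"
  using norm_on by (simp add: norm_on_def)

lemma N_uminus: "x \<in> carrier A \<Longrightarrow> N (\<ominus> x) = N x"
  by (simp add: uminus_eq_scale N_scale)

lemma N_minus_commute:
  assumes "x \<in> carrier A" "y \<in> carrier A"
  shows "N (x \<ominus> y) = N (y \<ominus> x)"
proof -
  have "x \<ominus> y = \<ominus> (y \<ominus> x)"
    using assms by (simp add: a_minus_def minus_add a_comm)
  then show ?thesis using assms by (simp add: N_uminus)
qed

lemma N_minus_triangle:
  assumes "x \<in> carrier A" "y \<in> carrier A" "z \<in> carrier A"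
  shows "N (x \<ominus> z) \<le> N (x \<ominus> y) + N (y \<ominus> z)"
proof -
  have "x \<ominus> z = (x \<ominus> y) \<oplus> (y \<ominus> z)"
    using assms by (simp add: a_minus_def a_assoc r_neg1)
  then show ?thesis using assms N_add by simp
qed

lemma N_triangle_minus:
  assumes "x \<in> carrier A" "y \<in> carrier A"
  shows "\<bar>N x - N y\<bar> \<le> N (x \<ominus> y)"
proof -
  have "x = x \<ominus> \<zero>" "y = y \<ominus> \<zero>" using assms by (simp_all add: a_minus_def)
  then show ?thesis
    using N_minus_triangle[of x y \<zero>] N_minus_triangle[of y x \<zero>] N_minus_commute[of x y] assms
    by (simp add: abs_le_iff)
qed

text \<open>From \<open>\<parallel>x\<parallel>\<^sup>2 = \<parallel>x\<^sup>* x\<parallel> \<le> \<parallel>x\<^sup>*\<parallel> \<parallel>x\<parallel>\<close> one gets \<open>\<parallel>x\<parallel> \<le> \<parallel>x\<^sup>*\<parallel>\<close>, and \<open>*\<close> is an involution.\<close>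

lemma N_star:
  assumes "x \<in> carrier A" shows "N (star A x) = N x"
proof -
  have le: "N x \<le> N (star A x)" if "x \<in> carrier A" for x
  proof (cases "N x = 0")
    case False
    have "N x * N x \<le> N (star A x) * N x"
      using submult[of "star A x" x] that by (simp add: star_closed cstar_id power2_eq_square)
    then show ?thesis using False N_nonneg[OF that] by simp
  qed (use that in \<open>simp add: N_nonneg star_closed\<close>)
  show ?thesis
    using le[OF assms] le[of "star A x"] assms by (simp add: star_closed star_star)
qed

definition Cauchy_in :: "(nat \<Rightarrow> 'a) \<Rightarrow> bool" where
  "Cauchy_in u \<longleftrightarrow> (\<forall>n. u n \<in> carrier A) \<and>
     (\<forall>e>0. \<exists>n0. \<forall>m\<ge>n0. \<forall>n\<ge>n0. N (u m \<ominus> u n) < e)"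

text \<open>All closure properties of Cauchy sequences below are instances of this comparison of
  increments.\<close>

lemma Cauchy_inI:
  assumes u: "\<And>n. u n \<in> carrier A"
    and v: "Cauchy_in v" and w: "Cauchy_in w" and c: "0 \<le> c" "0 \<le> d"
    and le: "\<And>m n. N (u m \<ominus> u n) \<le> c * N (v m \<ominus> v n) + d * N (w m \<ominus> w n)"
  shows "Cauchy_in u"
  unfolding Cauchy_in_def
proof (intro conjI allI impI)
  fix e :: real assume "0 < e"
  define f where "f = e / (c + d + 1)"
  have "0 < f" using c \<open>0 < e\<close> by (simp add: f_def)
  then obtain n1 n2 where n1: "\<forall>m\<ge>n1. \<forall>n\<ge>n1. N (v m \<ominus> v n) < f"
    and n2: "\<forall>m\<ge>n2. \<forall>n\<ge>n2. N (w m \<ominus> w n) < f"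
    using v w unfolding Cauchy_in_def by meson
  have "N (u m \<ominus> u n) < e" if "m \<ge> max n1 n2" "n \<ge> max n1 n2" for m n
  proof -
    have "c * N (v m \<ominus> v n) + d * N (w m \<ominus> w n) \<le> c * f + d * f"
      using n1 n2 that c by (intro add_mono mult_left_mono) (auto intro: less_imp_le)
    also have "\<dots> < (c + d + 1) * f" using \<open>0 < f\<close> by (simp add: algebra_simps)
    also have "\<dots> = e" using c by (simp add: f_def)
    finally show ?thesis using le[of m n] by linarith
  qed
  then show "\<exists>n0. \<forall>m\<ge>n0. \<forall>n\<ge>n0. N (u m \<ominus> u n) < e" by blast
qed (rule u)

lemma Cauchy_in_carrier: "Cauchy_in u \<Longrightarrow> u n \<in> carrier A"
  by (simp add: Cauchy_in_def)

lemma Cauchy_in_const: "x \<in> carrier A \<Longrightarrow> Cauchy_in (\<lambda>n. x)"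
  by (auto simp: Cauchy_in_def a_minus_def r_neg N_eq_0_iff[THEN iffD2])

lemma Cauchy_in_norm_convergent:
  assumes "Cauchy_in u" shows "convergent (\<lambda>n. N (u n))"
proof -
  have "Cauchy (\<lambda>n. N (u n))"
    unfolding Cauchy_def dist_real_def
  proof (intro allI impI)
    fix e :: real assume "0 < e"
    then obtain n0 where n0: "\<forall>m\<ge>n0. \<forall>n\<ge>n0. N (u m \<ominus> u n) < e"
      using assms unfolding Cauchy_in_def by blast
    have "\<bar>N (u m) - N (u n)\<bar> < e" if "m \<ge> n0" "n \<ge> n0" for m n
      using n0[rule_format, OF that] N_triangle_minus[of "u m" "u n"]
        assms[THEN Cauchy_in_carrier] by fastforce
    then show "\<exists>n0. \<forall>m\<ge>n0. \<forall>n\<ge>n0. \<bar>N (u m) - N (u n)\<bar> < e" by blast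
  qed
  then show ?thesis by (simp add: Cauchy_convergent_iff)
qed

lemma Cauchy_in_bounded:
  assumes "Cauchy_in u"
  obtains K where "0 \<le> K" "\<And>n. N (u n) \<le> K"
proof -
  have "Bseq (\<lambda>n. N (u n))"
    using Cauchy_in_norm_convergent[OF assms] by (rule convergent_imp_Bseq)
  then obtain K where "0 < K" "\<And>n. norm (N (u n)) \<le> K" by (auto simp: Bseq_def)
  then show ?thesis using that[of K] by (auto simp: abs_le_iff less_imp_le)
qed

lemma Cauchy_in_add:
  assumes "Cauchy_in u" "Cauchy_in v" shows "Cauchy_in (\<lambda>n. u n \<oplus> v n)"
proof (rule Cauchy_inI[OF _ assms, of _ 1 1])
  fix m n
  note [simp] = assms[THEN Cauchy_in_carrier]
  have "(u m \<oplus> v m) \<ominus> (u n \<oplus> v n) = (u m \<ominus> u n) \<oplus> (v m \<ominus> v n)"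
    by (simp add: a_minus_def minus_add a_ac)
  then show "N ((u m \<oplus> v m) \<ominus> (u n \<oplus> v n)) \<le> 1 * N (u m \<ominus> u n) + 1 * N (v m \<ominus> v n)"
    by (simp add: N_add)
qed (use assms in \<open>auto simp: Cauchy_in_carrier\<close>)

lemma Cauchy_in_mult:
  assumes "Cauchy_in u" "Cauchy_in v" shows "Cauchy_in (\<lambda>n. u n \<otimes> v n)"
proof -
  obtain K where K: "0 \<le> K" "\<And>n. N (u n) \<le> K" by (rule Cauchy_in_bounded[OF assms(1)]) auto
  obtain L where L: "0 \<le> L" "\<And>n. N (v n) \<le> L" by (rule Cauchy_in_bounded[OF assms(2)]) auto
  show ?thesis
  proof (rule Cauchy_inI[OF _ assms, of _ L K])
    fix m n
    note [simp] = assms[THEN Cauchy_in_carrier]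
    \<comment> \<open>the product rule for differences\<close>
    have "u m \<otimes> v m \<ominus> u n \<otimes> v n = (u m \<ominus> u n) \<otimes> v m \<oplus> u n \<otimes> (v m \<ominus> v n)"
      by (simp add: a_minus_def l_distr r_distr l_minus r_minus a_ac r_neg1 r_neg2)
    then have "N (u m \<otimes> v m \<ominus> u n \<otimes> v n)
        \<le> N ((u m \<ominus> u n) \<otimes> v m) + N (u n \<otimes> (v m \<ominus> v n))"
      by (simp add: N_add)
    also have "\<dots> \<le> N (u m \<ominus> u n) * N (v m) + N (u n) * N (v m \<ominus> v n)"
      by (intro add_mono submult) simp_all
    also have "\<dots> \<le> N (u m \<ominus> u n) * L + K * N (v m \<ominus> v n)"
      using K L by (intro add_mono mult_mono) (auto simp: N_nonneg)
    finally show "N (u m \<otimes> v m \<ominus> u n \<otimes> v n) \<le> L * N (u m \<ominus> u n) + K * N (v m \<ominus> v n)"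
      by (simp add: mult.commute)
  qed (use assms K L in \<open>auto simp: Cauchy_in_carrier\<close>)
qed

lemma Cauchy_in_scale:
  assumes "Cauchy_in u" shows "Cauchy_in (\<lambda>n. c \<odot> u n)"
  by (rule Cauchy_inI[OF _ assms assms, of _ "cmod c" 0])
    (use assms in \<open>auto simp: Cauchy_in_carrier N_scale simp flip: scale_minus_right\<close>)

lemma Cauchy_in_uminus: "Cauchy_in u \<Longrightarrow> Cauchy_in (\<lambda>n. \<ominus> u n)"
  using Cauchy_in_scale[of u "-1"] by (simp add: uminus_eq_scale Cauchy_in_carrier)

lemma Cauchy_in_star:
  assumes "Cauchy_in u" shows "Cauchy_in (\<lambda>n. star A (u n))"
  by (rule Cauchy_inI[OF _ assms assms, of _ 1 0])
    (use assms in \<open>auto simp: Cauchy_in_carrier star_closed N_star simp flip: star_minus\<close>)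

text \<open>The completion is a quotient of an algebra of sequences, so that the general facts about quotients by
  \<open>*\<close>-ideals provide all its algebraic laws.\<close>

definition Cauchy_algebra :: "(nat \<Rightarrow> 'a) star_algebra" where
  "Cauchy_algebra =
     \<lparr>carrier = {u. Cauchy_in u}, monoid.mult = (\<lambda>u v n. u n \<otimes> v n), one = (\<lambda>n. \<one>),
      zero = (\<lambda>n. \<zero>), add = (\<lambda>u v n. u n \<oplus> v n),
      module.smult = (\<lambda>c u n. c \<odot> u n), star = (\<lambda>u n. star A (u n))\<rparr>"

lemma Cauchy_algebra_simps [simp]:
  "u \<in> carrier Cauchy_algebra \<longleftrightarrow> Cauchy_in u"
  "u \<otimes>\<^bsub>Cauchy_algebra\<^esub> v = (\<lambda>n. u n \<otimes> v n)"
  "\<one>\<^bsub>Cauchy_algebra\<^esub> = (\<lambda>n. \<one>)"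
  "\<zero>\<^bsub>Cauchy_algebra\<^esub> = (\<lambda>n. \<zero>)"
  "u \<oplus>\<^bsub>Cauchy_algebra\<^esub> v = (\<lambda>n. u n \<oplus> v n)"
  "c \<odot>\<^bsub>Cauchy_algebra\<^esub> u = (\<lambda>n. c \<odot> u n)"
  "star Cauchy_algebra u = (\<lambda>n. star A (u n))"
  by (simp_all add: Cauchy_algebra_def)

lemma star_algebra_Cauchy: "star_algebra Cauchy_algebra"
proof (rule star_algebraI)
  show "ring Cauchy_algebra"
  proof (intro ringI abelian_groupI monoidI)
    fix u assume "u \<in> carrier Cauchy_algebra"
    then show "\<exists>v\<in>carrier Cauchy_algebra. v \<oplus>\<^bsub>Cauchy_algebra\<^esub> u = \<zero>\<^bsub>Cauchy_algebra\<^esub>"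
      by (intro bexI[of _ "\<lambda>n. \<ominus> u n"]) (auto simp: Cauchy_in_uminus Cauchy_in_carrier l_neg)
  qed (auto simp: Cauchy_in_add Cauchy_in_mult Cauchy_in_const Cauchy_in_carrier a_ac m_assoc
      l_distr r_distr)
qed (auto simp: Cauchy_in_add Cauchy_in_mult Cauchy_in_scale Cauchy_in_star Cauchy_in_carrier
    scale_assoc scale_one scale_add_left scale_add_right smult_mult_left smult_mult_right
    star_closed star_star star_add star_smult star_mult)

lemma minus_Cauchy_algebra:
  assumes "Cauchy_in u" "Cauchy_in v"
  shows "u \<ominus>\<^bsub>Cauchy_algebra\<^esub> v = (\<lambda>n. u n \<ominus> v n)"
proof -
  interpret C: star_algebra Cauchy_algebra by (rule star_algebra_Cauchy)
  show ?thesis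
    using assms by (simp add: a_minus_def C.uminus_eq_scale uminus_eq_scale Cauchy_in_carrier)
qed

definition null_sequences :: "(nat \<Rightarrow> 'a) set" where
  "null_sequences = {u. Cauchy_in u \<and> (\<lambda>n. N (u n)) \<longlonglongrightarrow> 0}"

lemma null_sequences_dominated:
  assumes "Cauchy_in u" "v \<in> null_sequences" "\<And>n. N (u n) \<le> K * N (v n)"
  shows "u \<in> null_sequences"
proof -
  have "(\<lambda>n. K * N (v n)) \<longlonglongrightarrow> 0"
    using assms(2) by (intro tendsto_mult_right_zero) (simp add: null_sequences_def)
  moreover have "\<forall>\<^sub>F n in sequentially. norm (N (u n)) \<le> K * N (v n)"
    using assms by (simp add: N_nonneg Cauchy_in_carrier)
  ultimately have "(\<lambda>n. N (u n)) \<longlonglongrightarrow> 0"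
    by (rule Lim_null_comparison[rotated])
  then show ?thesis using assms(1) by (simp add: null_sequences_def)
qed

lemma null_sequences_Cauchy: "u \<in> null_sequences \<Longrightarrow> Cauchy_in u"
  by (simp add: null_sequences_def)

lemma star_ideal_null_sequences: "star_ideal Cauchy_algebra null_sequences"
proof -
  interpret C: star_algebra Cauchy_algebra by (rule star_algebra_Cauchy)
  have add: "(\<lambda>n. u n \<oplus> v n) \<in> null_sequences"
    if "u \<in> null_sequences" "v \<in> null_sequences" for u v
  proof -
    note uv = that[THEN null_sequences_Cauchy]
    have "(\<lambda>n. N (u n) + N (v n)) \<longlonglongrightarrow> 0"
      using that by (intro tendsto_add_zero) (simp_all add: null_sequences_def)
    moreover have "\<forall>\<^sub>F n in sequentially. norm (N (u n \<oplus> v n)) \<le> N (u n) + N (v n)"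
      using uv by (simp add: N_nonneg N_add Cauchy_in_carrier)
    ultimately have "(\<lambda>n. N (u n \<oplus> v n)) \<longlonglongrightarrow> 0"
      by (rule Lim_null_comparison[rotated])
    then show ?thesis using uv by (simp add: null_sequences_def Cauchy_in_add)
  qed
  have scale: "(\<lambda>n. c \<odot> u n) \<in> null_sequences" if "u \<in> null_sequences" for c u
    by (rule null_sequences_dominated[of _ u "cmod c"])
      (use that[THEN null_sequences_Cauchy] that in
        \<open>auto simp: Cauchy_in_scale N_scale Cauchy_in_carrier\<close>)
  have mult: "(\<lambda>n. u n \<otimes> v n) \<in> null_sequences" "(\<lambda>n. v n \<otimes> u n) \<in> null_sequences"
    if u: "u \<in> null_sequences" and v: "Cauchy_in v" for u v
  proof -
    obtain K where K: "0 \<le> K" "\<And>n. N (v n) \<le> K" by (rule Cauchy_in_bounded[OF v]) auto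
    note u' = null_sequences_Cauchy[OF u]
    note [simp] = u'[THEN Cauchy_in_carrier] v[THEN Cauchy_in_carrier]
    have "N (u n \<otimes> v n) \<le> K * N (u n)" "N (v n \<otimes> u n) \<le> K * N (u n)" for n
      using submult[of "u n" "v n"] submult[of "v n" "u n"]
        mult_right_mono[OF K(2)[of n] N_nonneg[of "u n"]] by (simp_all add: mult.commute)
    then show "(\<lambda>n. u n \<otimes> v n) \<in> null_sequences" "(\<lambda>n. v n \<otimes> u n) \<in> null_sequences"
      by (auto intro!: null_sequences_dominated[OF _ u] Cauchy_in_mult u' v)
  qed
  have "ideal null_sequences Cauchy_algebra"
  proof (rule idealI)
    show "ring Cauchy_algebra" by (rule C.ring_axioms)
    have "(\<lambda>n. \<zero>) \<in> null_sequences"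
      by (simp add: null_sequences_def Cauchy_in_const N_eq_0_iff[THEN iffD2])
    then have ne: "null_sequences \<noteq> {}" by blast
    show "subgroup null_sequences (add_monoid Cauchy_algebra)"
    proof (rule C.add.subgroupI)
      show "null_sequences \<subseteq> carrier Cauchy_algebra"
        by (auto simp: null_sequences_Cauchy)
      show "\<ominus>\<^bsub>Cauchy_algebra\<^esub> u \<in> null_sequences" if "u \<in> null_sequences" for u
        using scale[OF that, of "-1"] null_sequences_Cauchy[OF that]
        by (simp add: C.uminus_eq_scale)
    qed (use ne add in auto)
  qed (use mult in auto)
  moreover have "(\<lambda>n. star A (u n)) \<in> null_sequences" if "u \<in> null_sequences" for u
    by (rule null_sequences_dominated[of _ u 1])
      (use that[THEN null_sequences_Cauchy] that in
        \<open>auto simp: Cauchy_in_star N_star Cauchy_in_carrier\<close>)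
  ultimately show ?thesis
    using star_algebra_Cauchy by (intro star_ideal.intro star_ideal_axioms.intro) auto
qed

lemma Cauchy_in_minus:
  "\<lbrakk>Cauchy_in u; Cauchy_in v\<rbrakk> \<Longrightarrow> Cauchy_in (\<lambda>n. u n \<ominus> v n)"
  by (simp add: a_minus_def Cauchy_in_add Cauchy_in_uminus)

interpretation C: star_ideal Cauchy_algebra null_sequences
  by (rule star_ideal_null_sequences)

definition completion :: "(nat \<Rightarrow> 'a) set star_algebra" where
  "completion = quotient_star_algebra Cauchy_algebra null_sequences"

definition limit_class :: "(nat \<Rightarrow> 'a) \<Rightarrow> (nat \<Rightarrow> 'a) set" where
  "limit_class u = null_sequences +>\<^bsub>Cauchy_algebra\<^esub> u"

definition embedding :: "'a \<Rightarrow> (nat \<Rightarrow> 'a) set" where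
  "embedding x = limit_class (\<lambda>n. x)"

definition completion_norm :: "(nat \<Rightarrow> 'a) set \<Rightarrow> real" where
  "completion_norm P = lim (\<lambda>n. N ((SOME u. u \<in> P) n))"

lemma carrier_completion: "carrier completion = limit_class ` {u. Cauchy_in u}"
  by (auto simp: completion_def limit_class_def C.carrier_Q)

lemma limit_class_simps [simp]:
  assumes "Cauchy_in u" "Cauchy_in v"
  shows "limit_class u \<otimes>\<^bsub>completion\<^esub> limit_class v = limit_class (\<lambda>n. u n \<otimes> v n)"
    and "limit_class u \<oplus>\<^bsub>completion\<^esub> limit_class v = limit_class (\<lambda>n. u n \<oplus> v n)"
    and "limit_class u \<ominus>\<^bsub>completion\<^esub> limit_class v = limit_class (\<lambda>n. u n \<ominus> v n)"
  using assms by (simp_all add: completion_def limit_class_def minus_Cauchy_algebra)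

lemma limit_class_scale_star [simp]:
  assumes "Cauchy_in u"
  shows "c \<odot>\<^bsub>completion\<^esub> limit_class u = limit_class (\<lambda>n. c \<odot> u n)"
    and "star completion (limit_class u) = limit_class (\<lambda>n. star A (u n))"
  using assms by (simp_all add: completion_def limit_class_def)

lemma one_completion: "\<one>\<^bsub>completion\<^esub> = limit_class (\<lambda>n. \<one>)"
  by (simp add: completion_def limit_class_def C.one_Q)

lemma zero_completion: "\<zero>\<^bsub>completion\<^esub> = limit_class (\<lambda>n. \<zero>)"
  by (simp add: completion_def limit_class_def C.zero_Q)

lemma limit_class_eq_iff:
  assumes "Cauchy_in u" "Cauchy_in v"
  shows "limit_class u = limit_class v \<longleftrightarrow> (\<lambda>n. N (u n \<ominus> v n)) \<longlonglongrightarrow> 0"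
  using assms C.coset_eq_iff[of u v]
  by (simp add: limit_class_def minus_Cauchy_algebra null_sequences_def Cauchy_in_minus)

lemma star_algebra_completion: "star_algebra completion"
  unfolding completion_def by (rule C.star_algebra_Q)

text \<open>The norm of a class is defined through an arbitrarily chosen representative; any other one
  differs from it by a null sequence and therefore yields the same limit.\<close>

lemma tendsto_completion_norm:
  assumes u: "Cauchy_in u"
  shows "(\<lambda>n. N (u n)) \<longlonglongrightarrow> completion_norm (limit_class u)"
proof -
  define v where "v = (SOME v. v \<in> limit_class u)"
  have "u \<in> limit_class u"
    using u C.a_rcos_self by (simp add: limit_class_def)
  then have "v \<in> limit_class u" unfolding v_def some_in_eq by blast
  then have "v \<in> carrier Cauchy_algebra"
    using C.a_r_coset_subset_G[OF C.a_subset, of u] u by (auto simp: limit_class_def)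
  then have v: "Cauchy_in v" by simp
  have "v \<ominus>\<^bsub>Cauchy_algebra\<^esub> u \<in> null_sequences"
    using \<open>v \<in> limit_class u\<close> C.a_rcos_module_minus[OF C.ring_axioms, of u v] u v
    by (simp add: limit_class_def)
  then have "(\<lambda>n. N (v n \<ominus> u n)) \<longlonglongrightarrow> 0"
    using u v by (simp add: minus_Cauchy_algebra null_sequences_def)
  then have "(\<lambda>n. N (v n) - N (u n)) \<longlonglongrightarrow> 0"
    by (rule Lim_null_comparison[rotated])
      (use u v in \<open>simp add: N_triangle_minus Cauchy_in_carrier\<close>)
  moreover have "(\<lambda>n. N (v n)) \<longlonglongrightarrow> completion_norm (limit_class u)"
    using Cauchy_in_norm_convergent[OF v]
    by (simp add: completion_norm_def v_def convergent_LIMSEQ_iff)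
  ultimately have "(\<lambda>n. N (v n) - (N (v n) - N (u n))) \<longlonglongrightarrow> completion_norm (limit_class u) - 0"
    by (intro tendsto_diff)
  then show ?thesis by simp
qed

lemma completion_norm_eqI:
  "\<lbrakk>Cauchy_in u; (\<lambda>n. N (u n)) \<longlonglongrightarrow> r\<rbrakk> \<Longrightarrow> completion_norm (limit_class u) = r"
  using tendsto_completion_norm LIMSEQ_unique by blast

lemma embed_closed: "x \<in> carrier A \<Longrightarrow> embedding x \<in> carrier completion"
  by (simp add: embedding_def carrier_completion Cauchy_in_const)

lemma completion_norm_embed: "x \<in> carrier A \<Longrightarrow> completion_norm (embedding x) = N x"
  unfolding embedding_def by (rule completion_norm_eqI) (simp_all add: Cauchy_in_const)

lemma norm_on_completion: "norm_on completion completion_norm"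
proof -
  have "0 \<le> completion_norm (limit_class u)" if "Cauchy_in u" for u
    using tendsto_completion_norm[OF that] by (rule LIMSEQ_le_const)
      (use that in \<open>auto simp: N_nonneg Cauchy_in_carrier\<close>)
  moreover have "completion_norm (limit_class u) = 0 \<longleftrightarrow> limit_class u = limit_class (\<lambda>n. \<zero>)"
    if u: "Cauchy_in u" for u
  proof -
    have "(\<lambda>n. N (u n)) \<longlonglongrightarrow> 0 \<longleftrightarrow> completion_norm (limit_class u) = 0"
      using tendsto_completion_norm[OF u] LIMSEQ_unique by metis
    then show ?thesis
      using u by (simp add: limit_class_eq_iff Cauchy_in_const a_minus_def Cauchy_in_carrier)
  qed
  moreover have "completion_norm (limit_class (\<lambda>n. c \<odot> u n)) = cmod c * completion_norm (limit_class u)"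
    if u: "Cauchy_in u" for c u
    using u tendsto_mult_left[OF tendsto_completion_norm[OF u], of "cmod c"]
    by (intro completion_norm_eqI) (simp_all add: Cauchy_in_scale N_scale Cauchy_in_carrier)
  moreover have "completion_norm (limit_class (\<lambda>n. u n \<oplus> v n))
      \<le> completion_norm (limit_class u) + completion_norm (limit_class v)"
    if "Cauchy_in u" "Cauchy_in v" for u v
    by (rule LIMSEQ_le[OF tendsto_completion_norm[OF Cauchy_in_add[OF that]]
          tendsto_add[OF that[THEN tendsto_completion_norm]]])
      (use that in \<open>auto simp: N_add Cauchy_in_carrier\<close>)
  ultimately show ?thesis
    unfolding norm_on_def carrier_completion zero_completion by simp
qed

text \<open>A class is approximated by the terms of any sequence which represents it.\<close>

lemma completion_norm_minus_embed:
  assumes u: "Cauchy_in u"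
  shows "(\<lambda>k. completion_norm (limit_class u \<ominus>\<^bsub>completion\<^esub> embedding (u k))) \<longlonglongrightarrow> 0"
proof (rule LIMSEQ_I)
  fix e :: real assume "0 < e"
  then obtain n0 where n0: "\<forall>m\<ge>n0. \<forall>n\<ge>n0. N (u m \<ominus> u n) < e / 2"
    using u unfolding Cauchy_in_def by (meson half_gt_zero)
  have "norm (completion_norm (limit_class u \<ominus>\<^bsub>completion\<^esub> embedding (u k)) - 0) < e" if "k \<ge> n0" for k
  proof -
    have c: "Cauchy_in (\<lambda>n. u n \<ominus> u k)"
      using u by (intro Cauchy_in_minus Cauchy_in_const Cauchy_in_carrier)
    have eq: "limit_class u \<ominus>\<^bsub>completion\<^esub> embedding (u k) = limit_class (\<lambda>n. u n \<ominus> u k)"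
      using u by (simp add: embedding_def Cauchy_in_const Cauchy_in_carrier)
    have "completion_norm (limit_class (\<lambda>n. u n \<ominus> u k)) \<le> e / 2"
      using n0 that
      by (intro LIMSEQ_le_const2[OF tendsto_completion_norm[OF c]]) (auto intro: less_imp_le)
    moreover have "0 \<le> completion_norm (limit_class (\<lambda>n. u n \<ominus> u k))"
      using norm_on_completion c by (auto simp: norm_on_def carrier_completion)
    ultimately show ?thesis using \<open>0 < e\<close> by (simp add: eq)
  qed
  then show "\<exists>n0. \<forall>k\<ge>n0. norm (completion_norm (limit_class u \<ominus>\<^bsub>completion\<^esub> embedding (u k)) - 0) < e"
    by blast
qed

lemma embed_dense:
  assumes "y \<in> carrier completion" "0 < e"
  shows "\<exists>x\<in>carrier A. completion_norm (y \<ominus>\<^bsub>completion\<^esub> embedding x) < e"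
proof -
  obtain u where u: "Cauchy_in u" "y = limit_class u"
    using assms(1) by (auto simp: carrier_completion)
  obtain k where "norm (completion_norm (y \<ominus>\<^bsub>completion\<^esub> embedding (u k)) - 0) < e"
    using LIMSEQ_D[OF completion_norm_minus_embed[OF u(1)] assms(2)] u(2) by blast
  then show ?thesis using Cauchy_in_carrier[OF u(1)] by (intro bexI[of _ "u k"]) auto
qed

lemma cstar_normed_completion: "cstar_normed completion completion_norm"
proof (intro cstar_normed.intro cstar_normed_axioms.intro)
  show "star_algebra completion" by (rule star_algebra_completion)
  show "norm_on completion completion_norm" by (rule norm_on_completion)
next
  fix x y assume "x \<in> carrier completion" "y \<in> carrier completion"
  then obtain u v where uv: "Cauchy_in u" "Cauchy_in v" "x = limit_class u" "y = limit_class v"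
    by (auto simp: carrier_completion)
  then show "completion_norm (x \<otimes>\<^bsub>completion\<^esub> y) \<le> completion_norm x * completion_norm y"
    using LIMSEQ_le[OF tendsto_completion_norm[OF Cauchy_in_mult[OF uv(1,2)]]
        tendsto_mult[OF uv(1,2)[THEN tendsto_completion_norm]]]
    by (auto simp: submult Cauchy_in_carrier)
next
  fix x assume "x \<in> carrier completion"
  then obtain u where u: "Cauchy_in u" "x = limit_class u" by (auto simp: carrier_completion)
  have "(\<lambda>n. N (star A (u n) \<otimes> u n)) \<longlonglongrightarrow> (completion_norm x)\<^sup>2"
    using tendsto_power[OF tendsto_completion_norm[OF u(1)], of 2] u
    by (simp add: cstar_id Cauchy_in_carrier)
  then show "completion_norm (star completion x \<otimes>\<^bsub>completion\<^esub> x) = (completion_norm x)\<^sup>2"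
    using u by (simp add: Cauchy_in_star Cauchy_in_mult completion_norm_eqI)
qed

lemma star_hom_embed: "embedding \<in> star_hom A completion"
  by (simp add: star_hom_def ring_hom_def Pi_def embed_closed)
    (simp add: embedding_def Cauchy_in_const star_closed one_completion)

text \<open>A Cauchy sequence of classes \<open>P\<^sub>k\<close> is approximated by elements \<open>x\<^sub>k\<close> of the algebra up to \<open>1/(k+1)\<close>.
  The sequence \<open>x\<close> is then itself Cauchy, and its class is the limit of the \<open>P\<^sub>k\<close>.\<close>

lemma complete_completion: "complete_norm_on completion completion_norm"
  unfolding complete_norm_on_def
proof (intro conjI allI impI)
  show "norm_on completion completion_norm" by (rule norm_on_completion)
next
  interpret K: cstar_normed completion completion_norm by (rule cstar_normed_completion)
  fix P :: "nat \<Rightarrow> (nat \<Rightarrow> 'a) set"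
  assume P: "\<forall>n. P n \<in> carrier completion"
    and cauchy: "\<forall>e>0. \<exists>n0. \<forall>m\<ge>n0. \<forall>n\<ge>n0. completion_norm (P m \<ominus>\<^bsub>completion\<^esub> P n) < e"
  have "\<forall>k. \<exists>x\<in>carrier A. completion_norm (P k \<ominus>\<^bsub>completion\<^esub> embedding x) < 1 / real (Suc k)"
    using P by (intro allI embed_dense) auto
  then obtain x where x: "\<And>k. x k \<in> carrier A"
    and close: "\<And>k. completion_norm (P k \<ominus>\<^bsub>completion\<^esub> embedding (x k)) < 1 / real (Suc k)"
    by metis
  have emb [simp]: "embedding (x k) \<in> carrier completion" for k
    using x by (rule embed_closed)
  note [simp] = P[rule_format]
  have "Cauchy_in x"
    unfolding Cauchy_in_def
  proof (intro conjI allI impI)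
    fix e :: real assume "0 < e"
    then obtain n1 where n1: "\<And>m n. m \<ge> n1 \<Longrightarrow> n \<ge> n1 \<Longrightarrow> completion_norm (P m \<ominus>\<^bsub>completion\<^esub> P n) < e / 2"
      using cauchy by (meson half_gt_zero)
    obtain n2 where n2: "1 / real (Suc n2) < e / 4"
      using reals_Archimedean[of "e / 4"] \<open>0 < e\<close> by (auto simp: inverse_eq_divide)
    have "N (x m \<ominus> x n) < e" if mn: "m \<ge> max n1 n2" "n \<ge> max n1 n2" for m n
    proof -
      have small: "1 / real (Suc k) < e / 4" if "k \<ge> n2" for k
        using that by (intro le_less_trans[OF _ n2]) (simp add: frac_le)
      have "N (x m \<ominus> x n) = completion_norm (embedding (x m) \<ominus>\<^bsub>completion\<^esub> embedding (x n))"
        using completion_norm_embed[of "x m \<ominus> x n"] x by (simp add: embedding_def Cauchy_in_const)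
      also have "\<dots> \<le> completion_norm (embedding (x m) \<ominus>\<^bsub>completion\<^esub> P m)
          + (completion_norm (P m \<ominus>\<^bsub>completion\<^esub> P n) + completion_norm (P n \<ominus>\<^bsub>completion\<^esub> embedding (x n)))"
        using K.N_minus_triangle[of "embedding (x m)" "P m" "embedding (x n)"]
          K.N_minus_triangle[of "P m" "P n" "embedding (x n)"] by simp
      also have "\<dots> < e / 4 + (e / 2 + e / 4)"
        using close[of m] close[of n] small[of m] small[of n] n1[of m n] mn
          K.N_minus_commute[of "embedding (x m)" "P m"] by simp
      finally show ?thesis by simp
    qed
    then show "\<exists>n0. \<forall>m\<ge>n0. \<forall>n\<ge>n0. N (x m \<ominus> x n) < e" by blast
  qed (rule x)
  show "\<exists>y\<in>carrier completion. (\<lambda>n. completion_norm (P n \<ominus>\<^bsub>completion\<^esub> y)) \<longlonglongrightarrow> 0"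
  proof (intro bexI)
    show y: "limit_class x \<in> carrier completion"
      using \<open>Cauchy_in x\<close> by (simp add: carrier_completion)
    have "(\<lambda>k. 1 / real (Suc k)
        + completion_norm (limit_class x \<ominus>\<^bsub>completion\<^esub> embedding (x k))) \<longlonglongrightarrow> 0"
      using LIMSEQ_inverse_real_of_nat completion_norm_minus_embed[OF \<open>Cauchy_in x\<close>]
      by (intro tendsto_add_zero) (simp_all add: inverse_eq_divide)
    moreover
    have "norm (completion_norm (P k \<ominus>\<^bsub>completion\<^esub> limit_class x))
        \<le> 1 / real (Suc k) + completion_norm (limit_class x \<ominus>\<^bsub>completion\<^esub> embedding (x k))" for k
      using K.N_minus_triangle[of "P k" "embedding (x k)" "limit_class x"] close[of k] y
        K.N_minus_commute[of "embedding (x k)" "limit_class x"]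
        K.N_nonneg[of "P k \<ominus>\<^bsub>completion\<^esub> limit_class x"] by simp
    then have "\<forall>\<^sub>F k in sequentially. norm (completion_norm (P k \<ominus>\<^bsub>completion\<^esub> limit_class x))
        \<le> 1 / real (Suc k) + completion_norm (limit_class x \<ominus>\<^bsub>completion\<^esub> embedding (x k))"
      by simp
    ultimately show "(\<lambda>k. completion_norm (P k \<ominus>\<^bsub>completion\<^esub> limit_class x)) \<longlonglongrightarrow> 0"
      by (rule Lim_null_comparison[rotated])
  qed
qed

theorem pre_cstar_norm: "pre_cstar_norm A N"
proof -
  interpret K: cstar_normed completion completion_norm by (rule cstar_normed_completion)
  have "cstar_algebra completion completion_norm"
    by (intro cstar_algebra.intro cstar_algebra_axioms.intro star_algebra_completion
        complete_completion K.submult K.cstar_id)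
  then show ?thesis
    unfolding pre_cstar_norm_def
    using norm_on star_hom_embed completion_norm_embed embed_dense by blast
qed

end

section \<open>Free \<open>*\<close>-algebras and their ideals\<close>

lemma poly_mapping_induct [case_names single add]:
  fixes p :: "'a \<Rightarrow>\<^sub>0 'b::comm_monoid_add"
  assumes single: "\<And>w c. P (Poly_Mapping.single w c)"
    and add: "\<And>p q. P p \<Longrightarrow> P q \<Longrightarrow> P (p + q)"
  shows "P p"
proof (induction p rule: update_induct)
  case const
  show ?case using single[of undefined 0] by simp
next
  case (update p a b)
  have "Poly_Mapping.update a b p = p + Poly_Mapping.single a b"
    using update by (intro poly_mapping_eqI)
      (auto simp: lookup_update lookup_add lookup_single when_def in_keys_iff)
  then show ?case using add[OF update(3) single] by simp
qed

lemma word_induct [case_names zero Cons]: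
  fixes w :: "'g word"
  assumes "P 0" "\<And>l w. P w \<Longrightarrow> P (Word [l] + w)"
  shows "P w"
proof (cases w)
  case (Word ls)
  have "P (Word ls)"
  proof (induction ls)
    case Nil
    show ?case using assms(1) by (simp add: zero_word_def)
  next
    case (Cons l ls)
    show ?case using assms(2)[OF Cons, of l] by (simp add: plus_word_def)
  qed
  then show ?thesis using Word by simp
qed

lemma single_zero_times_commute:
  fixes p :: "'g::monoid_add \<Rightarrow>\<^sub>0 complex"
  shows "Poly_Mapping.single 0 c * p = p * Poly_Mapping.single 0 c"
  by (induction p rule: poly_mapping_induct) (simp_all add: mult_single distrib_left distrib_right mult.commute)

lemma letter_star_letter_star [simp]: "letter_star (letter_star l) = l"
  by (cases l) simp_all

lemma word_star_word_star [simp]: "word_star (word_star w) = w"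
  by (simp add: word_star_def rev_map o_def)

lemma word_star_zero [simp]: "word_star 0 = 0"
  by (simp add: word_star_def zero_word_def)

lemma word_star_plus: "word_star (v + w) = word_star w + word_star v"
  by (simp add: word_star_def plus_word_def)

lemma inj_word_star: "inj word_star"
  by (metis injI word_star_word_star)

abbreviation poly_star :: "('g word \<Rightarrow>\<^sub>0 complex) \<Rightarrow> 'g word \<Rightarrow>\<^sub>0 complex" where
  "poly_star \<equiv> star free_star_algebra"

lemma lookup_poly_star: "Poly_Mapping.lookup (poly_star p) w = cnj (Poly_Mapping.lookup p (word_star w))"
  by (simp add: free_star_algebra_def map.rep_eq map_key.rep_eq[OF inj_word_star] when_def)

lemma poly_star_single: "poly_star (Poly_Mapping.single w c) = Poly_Mapping.single (word_star w) (cnj c)"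
proof (rule poly_mapping_eqI)
  fix v
  have "w = word_star v \<longleftrightarrow> word_star w = v" by auto
  then show "Poly_Mapping.lookup (poly_star (Poly_Mapping.single w c)) v =
      Poly_Mapping.lookup (Poly_Mapping.single (word_star w) (cnj c)) v"
    by (simp add: lookup_poly_star lookup_single when_def)
qed

lemma poly_star_add: "poly_star (p + q) = poly_star p + poly_star q"
  by (rule poly_mapping_eqI) (simp add: lookup_poly_star lookup_add)

lemma poly_star_minus: "poly_star (p - q) = poly_star p - poly_star q"
  by (rule poly_mapping_eqI) (simp add: lookup_poly_star lookup_minus)

lemma poly_star_poly_star: "poly_star (poly_star p) = p"
  by (rule poly_mapping_eqI) (simp add: lookup_poly_star)

lemma poly_star_mult: "poly_star (p * q) = poly_star q * poly_star p"
proof (induction p rule: poly_mapping_induct)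
  case (single v c)
  show ?case
    by (induction q rule: poly_mapping_induct)
      (simp_all add: mult_single poly_star_single poly_star_add word_star_plus distrib_left distrib_right mult.commute)
qed (simp_all add: poly_star_add distrib_left distrib_right)

lemma free_star_algebra_simps [simp]:
  "carrier free_star_algebra = UNIV"
  "p \<otimes>\<^bsub>free_star_algebra\<^esub> q = p * q"
  "\<one>\<^bsub>free_star_algebra\<^esub> = 1"
  "\<zero>\<^bsub>free_star_algebra\<^esub> = 0"
  "p \<oplus>\<^bsub>free_star_algebra\<^esub> q = p + q"
  "c \<odot>\<^bsub>free_star_algebra\<^esub> p = Poly_Mapping.single 0 c * p"
  by (simp_all add: free_star_algebra_def mult_map_scale_conv_mult)

lemma star_algebra_free: "star_algebra (free_star_algebra :: ('g word \<Rightarrow>\<^sub>0 complex) star_algebra)"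
proof (rule star_algebraI)
  show "ring (free_star_algebra :: ('g word \<Rightarrow>\<^sub>0 complex) star_algebra)"
    by (intro ringI abelian_groupI monoidI)
      (auto simp: algebra_simps intro: exI[of _ "- p" for p])
next
  fix c and p q :: "'g word \<Rightarrow>\<^sub>0 complex"
  show "p \<otimes>\<^bsub>free_star_algebra\<^esub> (c \<odot>\<^bsub>free_star_algebra\<^esub> q) = c \<odot>\<^bsub>free_star_algebra\<^esub> (p \<otimes>\<^bsub>free_star_algebra\<^esub> q)"
    using single_zero_times_commute[of c p] by (simp flip: mult.assoc)
  show "poly_star (c \<odot>\<^bsub>free_star_algebra\<^esub> p) = cnj c \<odot>\<^bsub>free_star_algebra\<^esub> poly_star p"
    using single_zero_times_commute[of "cnj c" "poly_star p"]
    by (simp add: poly_star_mult poly_star_single)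
qed (auto simp: distrib_left distrib_right mult_single single_add poly_star_add poly_star_mult
    poly_star_poly_star mult.assoc[symmetric])

lemma minus_free_star_algebra [simp]: "p \<ominus>\<^bsub>free_star_algebra\<^esub> q = p - q"
proof -
  interpret F: star_algebra "free_star_algebra :: ('a word \<Rightarrow>\<^sub>0 complex) star_algebra"
    by (rule star_algebra_free)
  have "p \<ominus>\<^bsub>free_star_algebra\<^esub> q = p + Poly_Mapping.single 0 (- 1) * q"
    by (simp add: a_minus_def F.uminus_eq_scale)
  also have "\<dots> = p - q"
    by (simp add: single_uminus)
  finally show ?thesis .
qed

text \<open>The free algebra also carries the operations of the type class \<^class>\<open>ring_1\<close>. These criteria
  allow ideals to be treated in terms of them.\<close>

lemma ideal_free_star_algebraI:
  assumes "0 \<in> I" and "\<And>p q. p \<in> I \<Longrightarrow> q \<in> I \<Longrightarrow> p - q \<in> I"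
    and "\<And>p q. p \<in> I \<Longrightarrow> q * p \<in> I" and "\<And>p q. p \<in> I \<Longrightarrow> p * q \<in> I"
  shows "ideal I (free_star_algebra :: ('g word \<Rightarrow>\<^sub>0 complex) star_algebra)"
proof -
  interpret F: star_algebra "free_star_algebra :: ('g word \<Rightarrow>\<^sub>0 complex) star_algebra"
    by (rule star_algebra_free)
  have neg: "- p \<in> I" if "p \<in> I" for p using assms(2)[OF assms(1) that] by simp
  have add: "p + q \<in> I" if "p \<in> I" "q \<in> I" for p q
    using assms(2)[OF that(1) neg[OF that(2)]] by simp
  have inv: "\<ominus>\<^bsub>free_star_algebra\<^esub> p = - p" for p :: "'g word \<Rightarrow>\<^sub>0 complex"
    by (simp add: F.uminus_eq_scale single_uminus)
  show ?thesis
  proof (rule idealI)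
    show "subgroup I (add_monoid free_star_algebra)"
      by (rule F.add.subgroupI) (use assms(1) add neg in \<open>auto simp: inv\<close>)
  qed (use assms F.ring_axioms in auto)
qed

lemma
  assumes "ideal I free_star_algebra"
  shows ideal_free_zero: "0 \<in> I"
    and ideal_free_add: "p \<in> I \<Longrightarrow> q \<in> I \<Longrightarrow> p + q \<in> I"
    and ideal_free_left: "p \<in> I \<Longrightarrow> q * p \<in> I"
    and ideal_free_right: "p \<in> I \<Longrightarrow> p * q \<in> I"
proof -
  interpret ideal I free_star_algebra by fact
  show "0 \<in> I" using additive_subgroup.zero_closed[OF is_additive_subgroup] by simp
  show "p \<in> I \<Longrightarrow> q \<in> I \<Longrightarrow> p + q \<in> I"
    using additive_subgroup.a_closed[OF is_additive_subgroup] by simp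
  show "p \<in> I \<Longrightarrow> q * p \<in> I" using I_l_closed[of p q] by simp
  show "p \<in> I \<Longrightarrow> p * q \<in> I" using I_r_closed[of p q] by simp
qed

lemma star_ideal_generated:
  "star_ideal free_star_algebra (generated_star_ideal free_star_algebra S)"
proof -
  interpret F: star_algebra free_star_algebra by (rule star_algebra_free)
  define \<I> where "\<I> = {I. ideal I free_star_algebra \<and> poly_star ` I \<subseteq> I \<and> S \<subseteq> I}"
  have "UNIV \<in> \<I>" using F.oneideal by (simp add: \<I>_def)
  then have "ideal (\<Inter>\<I>) free_star_algebra"
    by (intro F.i_Intersect) (auto simp: \<I>_def)
  moreover have "poly_star p \<in> \<Inter>\<I>" if "p \<in> \<Inter>\<I>" for p
    using that by (auto simp: \<I>_def)
  ultimately show ?thesis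
    using star_algebra_free
    by (simp add: star_ideal_def star_ideal_axioms_def generated_star_ideal_def \<I>_def)
qed

lemma generated_star_ideal_superset: "S \<subseteq> generated_star_ideal free_star_algebra S"
  by (auto simp: generated_star_ideal_def)

lemma generated_star_ideal_least:
  assumes "ideal I free_star_algebra" "\<And>p. p \<in> I \<Longrightarrow> poly_star p \<in> I" "S \<subseteq> I"
  shows "generated_star_ideal free_star_algebra S \<subseteq> I"
  using assms by (auto simp: generated_star_ideal_def)

section \<open>Operator norms on complex inner product spaces\<close>

text \<open>Only the real part of a complex inner product enters, as adjoints and norms can be expressed by
  it. So a complex inner product space is a real one with a compatible multiplication by complex
  scalars.\<close>

locale complex_inner =
  fixes scaleC :: "complex \<Rightarrow> 'v::real_inner \<Rightarrow> 'v"
  assumes scaleC_add_right: "scaleC c (v + w) = scaleC c v + scaleC c w"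
    and scaleC_add_left: "scaleC (c + d) v = scaleC c v + scaleC d v"
    and scaleC_scaleC: "scaleC c (scaleC d v) = scaleC (c * d) v"
    and scaleC_of_real: "scaleC (complex_of_real r) v = r *\<^sub>R v"
    and norm_scaleC: "norm (scaleC c v) = cmod c * norm v"
    and inner_scaleC: "inner (scaleC c v) w = inner v (scaleC (cnj c) w)"
begin

lemma scaleC_one: "scaleC 1 v = v"
  using scaleC_of_real[of 1 v] by simp

lemma scaleC_zero: "scaleC 0 v = 0"
  using scaleC_of_real[of 0 v] by simp

lemma bounded_linear_scaleC: "bounded_linear (scaleC c)"
proof (rule bounded_linear_intro)
  show "scaleC c (r *\<^sub>R v) = r *\<^sub>R scaleC c v" for r v
    by (simp add: scaleC_scaleC mult.commute flip: scaleC_of_real)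
  show "norm (scaleC c v) \<le> norm v * cmod c" for v
    by (simp add: norm_scaleC)
qed (rule scaleC_add_right)

lemma onorm_scaleC:
  assumes f: "bounded_linear f"
  shows "onorm (\<lambda>v. scaleC c (f v)) = cmod c * onorm f"
proof -
  have le: "onorm (\<lambda>v. scaleC c (f v)) \<le> cmod c * onorm f" if f: "bounded_linear f" for c f
  proof (rule onorm_bound)
    show "0 \<le> cmod c * onorm f" using onorm_pos_le[OF f] by simp
    show "norm (scaleC c (f v)) \<le> cmod c * onorm f * norm v" for v
      using onorm[OF f, of v] by (simp add: norm_scaleC mult.assoc mult_left_mono)
  qed
  show ?thesis
  proof (cases "c = 0")
    case False
    have "onorm f = onorm (\<lambda>v. scaleC (inverse c) (scaleC c (f v)))"
      using False by (simp add: scaleC_scaleC scaleC_one)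
    also have "\<dots> \<le> cmod (inverse c) * onorm (\<lambda>v. scaleC c (f v))"
      by (intro le bounded_linear_compose[OF bounded_linear_scaleC f])
    finally have "cmod c * onorm f \<le> onorm (\<lambda>v. scaleC c (f v))"
      using False by (simp add: norm_inverse norm_divide field_simps)
    then show ?thesis using le[OF f, of c] by simp
  qed (simp add: scaleC_zero onorm_zero)
qed

end

lemma onorm_le_onorm_adjoint:
  fixes f g :: "'v::real_inner \<Rightarrow> 'v"
  assumes g: "bounded_linear g" and adj: "\<And>v w. inner (f v) w = inner v (g w)"
  shows "onorm f \<le> onorm g"
proof (rule onorm_bound)
  show "0 \<le> onorm g" by (rule onorm_pos_le[OF g])
  fix v
  have "norm (f v) * norm (f v) = inner v (g (f v))"
    using adj[of v "f v"] by (simp add: power2_norm_eq_inner flip: power2_eq_square)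
  also have "\<dots> \<le> norm v * norm (g (f v))" by (rule norm_cauchy_schwarz)
  also have "\<dots> \<le> norm v * (onorm g * norm (f v))"
    by (intro mult_left_mono onorm[OF g]) simp
  finally have "norm (f v) * norm (f v) \<le> (onorm g * norm v) * norm (f v)"
    by (simp add: mult_ac)
  then show "norm (f v) \<le> onorm g * norm v"
    by (cases "norm (f v) = 0") (auto simp: onorm_pos_le[OF g])
qed

text \<open>This is the \<open>C\<^sup>*\<close>-identity. By the Cauchy-Schwarz inequality
  \<open>\<parallel>f v\<parallel>\<^sup>2 = \<langle>v, g (f v)\<rangle> \<le> \<parallel>g \<circ> f\<parallel> \<parallel>v\<parallel>\<^sup>2\<close>, which bounds \<open>\<parallel>f\<parallel>\<^sup>2\<close> by
  \<open>\<parallel>g \<circ> f\<parallel>\<close>. Conversely \<open>\<parallel>g \<circ> f\<parallel> \<le> \<parallel>g\<parallel> \<parallel>f\<parallel>\<close>, and an adjoint does not have a larger norm.\<close>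

lemma onorm_adjoint_compose:
  fixes f g :: "'v::real_inner \<Rightarrow> 'v"
  assumes f: "bounded_linear f" and g: "bounded_linear g"
    and adj: "\<And>v w. inner (f v) w = inner v (g w)"
  shows "onorm (g \<circ> f) = (onorm f)\<^sup>2"
proof (rule antisym)
  have gf: "bounded_linear (g \<circ> f)" using bounded_linear_compose[OF g f] by (simp add: o_def)
  have "onorm g \<le> onorm f"
    by (rule onorm_le_onorm_adjoint[OF f]) (metis adj inner_commute)
  then have "onorm g * onorm f \<le> onorm f * onorm f"
    by (intro mult_right_mono onorm_pos_le f)
  then show "onorm (g \<circ> f) \<le> (onorm f)\<^sup>2"
    using onorm_compose[OF g f] by (simp add: power2_eq_square)
  have "onorm f \<le> sqrt (onorm (g \<circ> f))"
  proof (rule onorm_bound)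
    show "0 \<le> sqrt (onorm (g \<circ> f))" using onorm_pos_le[OF gf] by simp
    fix v
    have "(norm (f v))\<^sup>2 = inner v ((g \<circ> f) v)"
      by (simp add: adj power2_norm_eq_inner)
    also have "\<dots> \<le> norm v * norm ((g \<circ> f) v)" by (rule norm_cauchy_schwarz)
    also have "\<dots> \<le> norm v * (onorm (g \<circ> f) * norm v)"
      by (intro mult_left_mono onorm[OF gf]) simp
    finally have "sqrt ((norm (f v))\<^sup>2) \<le> sqrt (onorm (g \<circ> f) * (norm v)\<^sup>2)"
      by (intro real_sqrt_le_mono) (simp add: power2_eq_square mult_ac)
    then show "norm (f v) \<le> sqrt (onorm (g \<circ> f)) * norm v"
      by (simp add: real_sqrt_mult)
  qed
  then have "(onorm f)\<^sup>2 \<le> (sqrt (onorm (g \<circ> f)))\<^sup>2"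
    using onorm_pos_le[OF f] by (intro power_mono)
  then show "(onorm f)\<^sup>2 \<le> onorm (g \<circ> f)"
    using onorm_pos_le[OF gf] by simp
qed

section \<open>Representations of presented \<open>*\<close>-algebras\<close>

text \<open>A \<open>*\<close>-representation of the free \<open>*\<close>-algebra is the same as a choice of operators for the letters in
  which the letters \<open>g\<close> and \<open>g\<^sup>*\<close> act by adjoint operators.\<close>

locale letter_representation = complex_inner scaleC
  for scaleC :: "complex \<Rightarrow> 'v::real_inner \<Rightarrow> 'v" +
  fixes T :: "'g letter \<Rightarrow> 'v \<Rightarrow> 'v"
  assumes bounded_T: "bounded_linear (T l)"
    and T_scaleC: "T l (scaleC c v) = scaleC c (T l v)"
    and T_adjoint: "inner (T l v) w = inner v (T (letter_star l) w)"
begin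

definition word_op :: "'g word \<Rightarrow> 'v \<Rightarrow> 'v" where
  "word_op w = foldr (\<lambda>l f. T l \<circ> f) (letters w) id"

definition rep :: "('g word \<Rightarrow>\<^sub>0 complex) \<Rightarrow> 'v \<Rightarrow> 'v" where
  "rep p v = (\<Sum>w\<in>Poly_Mapping.keys p. scaleC (Poly_Mapping.lookup p w) (word_op w v))"

lemma word_op_plus: "word_op (u + w) = word_op u \<circ> word_op w"
proof -
  have *: "foldr (\<lambda>l f. T l \<circ> f) us g = foldr (\<lambda>l f. T l \<circ> f) us id \<circ> g" for us and g :: "'v \<Rightarrow> 'v"
    by (induction us) (simp_all add: o_assoc[symmetric])
  show ?thesis by (simp add: word_op_def plus_word_def) (rule *)
qed

lemma word_op_zero [simp]: "word_op 0 = id"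
  by (simp add: word_op_def zero_word_def)

lemma word_op_letter [simp]: "word_op (Word [l]) = T l"
  by (simp add: word_op_def)

lemma bounded_word_op: "bounded_linear (word_op w)"
proof (induction w rule: word_induct)
  case zero
  show ?case by (simp add: id_def bounded_linear_ident)
next
  case (Cons l w)
  show ?case
    using bounded_linear_compose[OF bounded_T Cons] by (simp add: word_op_plus o_def)
qed

lemma word_op_scaleC: "word_op w (scaleC c v) = scaleC c (word_op w v)"
proof (induction w rule: word_induct)
  case zero
  show ?case by simp
next
  case (Cons l w)
  show ?case unfolding word_op_plus o_apply Cons by (simp add: T_scaleC)
qed

lemma word_op_adjoint: "inner (word_op w v) u = inner v (word_op (word_star w) u)"
proof (induction w arbitrary: v u rule: word_induct)
  case (Cons l w)
  have "word_star (Word [l]) = Word [letter_star l]" by (simp add: word_star_def)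
  then show ?case using Cons by (simp add: word_op_plus word_star_plus T_adjoint)
qed simp

lemma rep_superset:
  assumes "finite F" "Poly_Mapping.keys p \<subseteq> F"
  shows "rep p v = (\<Sum>w\<in>F. scaleC (Poly_Mapping.lookup p w) (word_op w v))"
  unfolding rep_def using assms
  by (intro sum.mono_neutral_left) (auto simp: in_keys_iff scaleC_zero)

lemma rep_single: "rep (Poly_Mapping.single w c) v = scaleC c (word_op w v)"
  by (subst rep_superset[of "{w}"]) auto

lemma rep_add: "rep (p + q) v = rep p v + rep q v"
  using keys_add[of p q]
  by (simp add: rep_superset[of "Poly_Mapping.keys p \<union> Poly_Mapping.keys q"]
      lookup_add scaleC_add_left sum.distrib)

lemma bounded_rep: "bounded_linear (rep p)"
  unfolding rep_def
  by (intro bounded_linear_sum bounded_linear_compose[OF bounded_linear_scaleC] bounded_word_op)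

lemma rep_mult: "rep (p * q) v = rep p (rep q v)"
proof (induction p rule: poly_mapping_induct)
  case (single w c)
  show ?case
    by (induction q rule: poly_mapping_induct)
      (simp_all add: mult_single distrib_left rep_single rep_add word_op_plus word_op_scaleC
        scaleC_scaleC scaleC_add_right linear_add[OF bounded_linear.linear[OF bounded_word_op]])
qed (simp add: distrib_right rep_add)

lemma rep_zero: "rep 0 v = 0"
  by (simp add: rep_def)

lemma rep_one: "rep 1 v = v"
  using rep_single[of 0 1 v] by (simp add: scaleC_one)

lemma rep_scale: "rep (Poly_Mapping.single 0 c * p) v = scaleC c (rep p v)"
  by (simp add: rep_mult rep_single)

lemma rep_minus: "rep (p - q) v = rep p v - rep q v"
  using rep_add[of "p - q" q v] by (simp add: algebra_simps)

lemma rep_adjoint: "inner (rep p v) u = inner v (rep (poly_star p) u)"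
  by (induction p rule: poly_mapping_induct)
    (simp_all add: rep_single rep_add poly_star_single poly_star_add inner_scaleC inner_add_left
      inner_add_right word_op_adjoint flip: word_op_scaleC)

text \<open>The kernel of a representation is a \<open>*\<close>-ideal. It is closed under \<open>*\<close> since the adjoint of
  the zero operator is zero.\<close>

lemma rep_eq_0_on_generated:
  assumes S: "\<And>r v. r \<in> S \<Longrightarrow> rep r v = 0"
    and p: "p \<in> generated_star_ideal free_star_algebra S"
  shows "rep p v = 0"
proof -
  define K where "K = {p. \<forall>v. rep p v = 0}"
  have "generated_star_ideal free_star_algebra S \<subseteq> K"
  proof (rule generated_star_ideal_least)
    show "ideal K free_star_algebra"
      by (rule ideal_free_star_algebraI)
        (auto simp: K_def rep_zero rep_minus rep_mult linear_0[OF bounded_linear.linear[OF bounded_rep]])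
    show "poly_star p \<in> K" if "p \<in> K" for p
    proof -
      have "inner (rep (poly_star p) v) (rep (poly_star p) v) = 0" for v
        using that rep_adjoint[of p "rep (poly_star p) v" v] by (simp add: K_def inner_commute)
      then show ?thesis by (simp add: K_def)
    qed
    show "S \<subseteq> K" using S by (auto simp: K_def)
  qed
  then show ?thesis using p by (auto simp: K_def)
qed

text \<open>A coset acts by any of its elements once the relations act by zero.\<close>

definition rep_norm :: "('g word \<Rightarrow>\<^sub>0 complex) set \<Rightarrow> real" where
  "rep_norm P = onorm (rep (SOME p. p \<in> P))"

context
  fixes S :: "('g word \<Rightarrow>\<^sub>0 complex) set"
  assumes relations: "\<And>r v. r \<in> S \<Longrightarrow> rep r v = 0"
begin

interpretation I: star_ideal free_star_algebra "generated_star_ideal free_star_algebra S"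
  by (rule star_ideal_generated)

lemma rep_norm_coset:
  "rep_norm (generated_star_ideal free_star_algebra S +>\<^bsub>free_star_algebra\<^esub> p) = onorm (rep p)"
proof -
  define p' where "p' = (SOME p'. p' \<in> generated_star_ideal free_star_algebra S +>\<^bsub>free_star_algebra\<^esub> p)"
  have "p' \<in> generated_star_ideal free_star_algebra S +>\<^bsub>free_star_algebra\<^esub> p"
    unfolding p'_def some_in_eq using I.a_rcos_self by fastforce
  then have "p' - p \<in> generated_star_ideal free_star_algebra S"
    using I.a_rcos_module_minus[OF I.ring_axioms, of p p'] by simp
  then have "rep (p' - p) v = 0" for v using rep_eq_0_on_generated relations by blast
  then have "rep p' = rep p" by (simp add: fun_eq_iff rep_minus)
  then show ?thesis by (simp add: rep_norm_def p'_def)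
qed

text \<open>The kernel contains the ideal because the relations are satisfied; faithfulness says that it is
  no larger, which makes the operator norm definite on the quotient.\<close>

theorem pre_cstar_norm_rep_norm:
  assumes faithful: "\<And>p. (\<And>v. rep p v = 0) \<Longrightarrow> p \<in> generated_star_ideal free_star_algebra S"
  shows "pre_cstar_norm (presented_star_algebra S) rep_norm"
proof -
  have "cstar_normed I.Q rep_norm"
  proof (intro cstar_normed.intro cstar_normed_axioms.intro)
    show "star_algebra I.Q" by (rule I.star_algebra_Q)
    have "onorm (rep p) = 0 \<longleftrightarrow>
        generated_star_ideal free_star_algebra S +>\<^bsub>free_star_algebra\<^esub> p =
        generated_star_ideal free_star_algebra S +>\<^bsub>free_star_algebra\<^esub> 0" for p
      using faithful[of p] rep_eq_0_on_generated[OF relations, where p = p] I.coset_eq_iff[of p 0]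
      by (auto simp: onorm_eq_0[OF bounded_rep])
    moreover have "onorm (rep (p + q)) \<le> onorm (rep p) + onorm (rep q)" for p q
      using onorm_triangle[OF bounded_rep bounded_rep] by (simp add: rep_add[abs_def])
    ultimately show "norm_on I.Q rep_norm"
      by (simp add: norm_on_def I.carrier_Q I.zero_Q rep_norm_coset onorm_pos_le[OF bounded_rep]
          rep_scale[abs_def] onorm_scaleC[OF bounded_rep])
  next
    fix x y assume "x \<in> carrier I.Q" "y \<in> carrier I.Q"
    then show "rep_norm (x \<otimes>\<^bsub>I.Q\<^esub> y) \<le> rep_norm x * rep_norm y"
      using onorm_compose[OF bounded_rep bounded_rep]
      by (auto simp: I.carrier_Q rep_norm_coset rep_mult[abs_def] o_def)
  next
    fix x assume "x \<in> carrier I.Q"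
    then show "rep_norm (star I.Q x \<otimes>\<^bsub>I.Q\<^esub> x) = (rep_norm x)\<^sup>2"
      using onorm_adjoint_compose[OF bounded_rep bounded_rep rep_adjoint]
      by (auto simp: I.carrier_Q rep_norm_coset rep_mult[abs_def] o_def)
  qed
  then show ?thesis
    unfolding presented_star_algebra_def by (rule cstar_normed.pre_cstar_norm)
qed

end

end

section \<open>Finitely supported functions\<close>

text \<open>The type \<open>'a \<Rightarrow>\<^sub>0 complex\<close> is the natural home of these functions, but its customary norm is the sum
  of the moduli. A separate type makes room for the \<open>\<ell>\<^sup>2\<close>-norm.\<close>

typedef 'i finsupp = "{f :: 'i \<Rightarrow> complex. finite {x. f x \<noteq> 0}}"
  morphisms entry Finsupp
  by (rule exI[of _ "\<lambda>_. 0"]) simp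

setup_lifting type_definition_finsupp

lemma finite_support [simp]: "finite {x. entry v x \<noteq> 0}"
  using entry[of v] by simp

lemma finsupp_eqI: "(\<And>x. entry v x = entry w x) \<Longrightarrow> v = w"
  by (simp add: entry_inject[symmetric] fun_eq_iff)

instantiation finsupp :: (type) real_vector
begin

lift_definition zero_finsupp :: "'a finsupp" is "\<lambda>_. 0" by simp

lift_definition plus_finsupp :: "'a finsupp \<Rightarrow> 'a finsupp \<Rightarrow> 'a finsupp"
  is "\<lambda>f g x. f x + g x"
  subgoal for f g by (rule finite_subset[of _ "{x. f x \<noteq> 0} \<union> {x. g x \<noteq> 0}"]) auto
  done

lift_definition uminus_finsupp :: "'a finsupp \<Rightarrow> 'a finsupp" is "\<lambda>f x. - f x" by simp

lift_definition minus_finsupp :: "'a finsupp \<Rightarrow> 'a finsupp \<Rightarrow> 'a finsupp"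
  is "\<lambda>f g x. f x - g x"
  subgoal for f g by (rule finite_subset[of _ "{x. f x \<noteq> 0} \<union> {x. g x \<noteq> 0}"]) auto
  done

lift_definition scaleR_finsupp :: "real \<Rightarrow> 'a finsupp \<Rightarrow> 'a finsupp" is "\<lambda>r f x. r *\<^sub>R f x"
  by (rule finite_subset[rotated]) auto

instance
  by standard (transfer; simp add: fun_eq_iff algebra_simps)+

end

lemmas entry_simps [simp] = zero_finsupp.rep_eq plus_finsupp.rep_eq uminus_finsupp.rep_eq
  minus_finsupp.rep_eq scaleR_finsupp.rep_eq

instantiation finsupp :: (type) real_inner
begin

definition inner_finsupp :: "'a finsupp \<Rightarrow> 'a finsupp \<Rightarrow> real" where
  "inner v w = (\<Sum>x | entry v x \<noteq> 0. inner (entry v x) (entry w x))"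

definition norm_finsupp :: "'a finsupp \<Rightarrow> real" where "norm (v :: 'a finsupp) = sqrt (inner v v)"
definition dist_finsupp :: "'a finsupp \<Rightarrow> 'a finsupp \<Rightarrow> real" where "dist (v :: 'a finsupp) w = norm (v - w)"
definition sgn_finsupp :: "'a finsupp \<Rightarrow> 'a finsupp" where "sgn (v :: 'a finsupp) = v /\<^sub>R norm v"
definition uniformity_finsupp :: "('a finsupp \<times> 'a finsupp) filter" where
  "uniformity_finsupp = (INF e\<in>{0<..}. principal {(v, w :: 'a finsupp). dist v w < e})"
definition open_finsupp :: "'a finsupp set \<Rightarrow> bool" where
  "open_finsupp U = (\<forall>x\<in>U. \<forall>\<^sub>F (x', y) in uniformity. x' = x \<longrightarrow> y \<in> U)"

lemma inner_finsupp_superset: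
  fixes v w :: "'a finsupp"
  assumes "finite F" "{x. entry v x \<noteq> 0} \<subseteq> F"
  shows "inner v w = (\<Sum>x\<in>F. inner (entry v x) (entry w x))"
  unfolding inner_finsupp_def using assms by (intro sum.mono_neutral_left) auto

instance
proof
  fix u v w :: "'a finsupp" and r :: real
  have F: "finite ({x. entry u x \<noteq> 0} \<union> {x. entry v x \<noteq> 0})" by simp
  show "inner u v = inner v u"
    using inner_finsupp_superset[OF F, of u v] inner_finsupp_superset[OF F, of v u]
    by (simp add: inner_commute)
  have "{x. entry (u + v) x \<noteq> 0} \<subseteq> {x. entry u x \<noteq> 0} \<union> {x. entry v x \<noteq> 0}"
    by auto
  then show "inner (u + v) w = inner u w + inner v w"
    using inner_finsupp_superset[OF F, of u w] inner_finsupp_superset[OF F, of v w]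
      inner_finsupp_superset[OF F, of "u + v" w]
    by (simp add: inner_add_left sum.distrib)
  show "inner (r *\<^sub>R u) v = r * inner u v"
    using inner_finsupp_superset[OF finite_support[of u], of "r *\<^sub>R u" v]
    by (auto simp: inner_finsupp_def sum_distrib_left)
  show "0 \<le> inner u u"
    by (auto simp: inner_finsupp_def intro: sum_nonneg)
  show "inner u u = 0 \<longleftrightarrow> u = 0"
    by (auto simp: inner_finsupp_def sum_nonneg_eq_0_iff intro: finsupp_eqI)
qed (simp_all add: norm_finsupp_def dist_finsupp_def sgn_finsupp_def uniformity_finsupp_def
    open_finsupp_def)

end

lemma inner_finsupp_swap:
  "inner v w = (\<Sum>x | entry w x \<noteq> 0. inner (entry v x) (entry w x))"
  by (subst inner_commute) (simp add: inner_finsupp_def inner_commute)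

lift_definition scaleC :: "complex \<Rightarrow> 'i finsupp \<Rightarrow> 'i finsupp" is "\<lambda>c f x. c * f x"
  by (rule finite_subset[rotated]) auto

lemmas entry_scaleC [simp] = scaleC.rep_eq

lemma norm_finsupp_eq: "norm v = sqrt (\<Sum>x | entry v x \<noteq> 0. (cmod (entry v x))\<^sup>2)"
  by (simp add: norm_finsupp_def inner_finsupp_def power2_norm_eq_inner)

lemma complex_inner_finsupp: "complex_inner (scaleC :: complex \<Rightarrow> 'i finsupp \<Rightarrow> 'i finsupp)"
proof
  fix c d :: complex and v w :: "'i finsupp" and r :: real
  show "norm (scaleC c v) = cmod c * norm v"
    by (cases "c = 0")
      (simp_all add: norm_finsupp_eq norm_mult power_mult_distrib real_sqrt_mult flip: sum_distrib_left)
  have "inner (c * a) b = inner a (cnj c * b)" for a b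
    by (simp add: inner_complex_def algebra_simps)
  moreover have "inner (scaleC c v) w = (\<Sum>x | entry v x \<noteq> 0. inner (entry (scaleC c v) x) (entry w x))"
    by (rule inner_finsupp_superset) auto
  ultimately show "inner (scaleC c v) w = inner v (scaleC (cnj c) w)"
    by (simp add: inner_finsupp_def)
qed (auto intro!: finsupp_eqI simp: algebra_simps scaleR_conv_of_real)

lift_definition unit_vec :: "'i \<Rightarrow> 'i finsupp" is "\<lambda>i x. if x = i then 1 else 0" by simp

lemma entry_unit_vec [simp]: "entry (unit_vec i) x = (if x = i then 1 else 0)"
  by (simp add: unit_vec.rep_eq)

lemma norm_unit_vec [simp]: "norm (unit_vec i) = 1"
  by (simp add: norm_finsupp_eq)

section \<open>A normal form in \<open>Pol(SU\<^sub>q(2))\<close>\<close>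

abbreviation const :: "complex \<Rightarrow> 'g word \<Rightarrow>\<^sub>0 complex" where
  "const \<equiv> Poly_Mapping.single 0"

abbreviation letter :: "'g letter \<Rightarrow> 'g word \<Rightarrow>\<^sub>0 complex" where
  "letter l \<equiv> Poly_Mapping.single (Word [l]) 1"

lemma suq2_letter_cases:
  obtains "l = Gen Alpha" | "l = Adj Alpha" | "l = Gen Gamma" | "l = Adj Gamma"
proof (cases l)
  case (Gen g)
  then show ?thesis using that by (cases g) auto
next
  case (Adj g)
  then show ?thesis using that by (cases g) auto
qed

lemma word_star_letter: "word_star (Word [l]) = Word [letter_star l]"
  by (simp add: word_star_def)

lemma const_mult: "const s * const t = const (s * t)"
  by (simp add: mult_single)

lemma const_left_commute: "p * (const t * r) = const t * (p * r)"
  by (metis mult.assoc single_zero_times_commute)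

text \<open>The normal form is derived in the free algebra, by computing modulo the ideal of relations.\<close>

locale suq2_ideal =
  fixes q :: real and I :: "(suq2_generator word \<Rightarrow>\<^sub>0 complex) set"
  assumes q_nonzero: "q \<noteq> 0"
  defines "I \<equiv> generated_star_ideal free_star_algebra (suq2_relations q)"
begin

abbreviation "a \<equiv> letter (Gen Alpha)"
abbreviation "a' \<equiv> letter (Adj Alpha)"
abbreviation "c \<equiv> letter (Gen Gamma)"
abbreviation "c' \<equiv> letter (Adj Gamma)"

lemma star_ideal_I: "star_ideal free_star_algebra I"
  unfolding I_def by (rule star_ideal_generated)

lemma
  shows I_zero: "0 \<in> I" and I_add: "x \<in> I \<Longrightarrow> y \<in> I \<Longrightarrow> x + y \<in> I"
    and I_left: "x \<in> I \<Longrightarrow> y * x \<in> I" and I_right: "x \<in> I \<Longrightarrow> x * y \<in> I"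
    and I_star: "x \<in> I \<Longrightarrow> poly_star x \<in> I"
  using ideal_free_zero ideal_free_add ideal_free_left ideal_free_right star_ideal_I
    star_ideal.star_mem star_ideal.axioms(2)
  by metis+

definition eqv (infix "\<sim>\<^sub>I" 50) where "x \<sim>\<^sub>I y \<longleftrightarrow> x - y \<in> I"

lemma eqv_refl [simp]: "x \<sim>\<^sub>I x"
  by (simp add: eqv_def I_zero)

lemma eqv_trans [trans]: "x \<sim>\<^sub>I y \<Longrightarrow> y \<sim>\<^sub>I z \<Longrightarrow> x \<sim>\<^sub>I z"
  using I_add[of "x - y" "y - z"] by (simp add: eqv_def)

lemma eqv_sym: "x \<sim>\<^sub>I y \<Longrightarrow> y \<sim>\<^sub>I x"
  using I_left[of "x - y" "- 1"] by (simp add: eqv_def)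

lemma eqv_left: "x \<sim>\<^sub>I y \<Longrightarrow> z * x \<sim>\<^sub>I z * y"
  using I_left[of "x - y" z] by (simp add: eqv_def right_diff_distrib)

lemma eqv_right: "x \<sim>\<^sub>I y \<Longrightarrow> x * z \<sim>\<^sub>I y * z"
  using I_right[of "x - y" z] by (simp add: eqv_def left_diff_distrib)

lemma eqv_star: "x \<sim>\<^sub>I y \<Longrightarrow> poly_star x \<sim>\<^sub>I poly_star y"
  using I_star[of "x - y"] by (simp add: eqv_def poly_star_minus)

lemma relations:
  shows "c' * c \<sim>\<^sub>I c * c'" and "const q * c' * a \<sim>\<^sub>I a * c'" and "const q * c * a \<sim>\<^sub>I a * c"
    and "a' * a + c' * c \<sim>\<^sub>I 1" and "a * a' + const (q\<^sup>2) * c * c' \<sim>\<^sub>I 1"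
  using generated_star_ideal_superset[of "suq2_relations q", folded I_def]
  by (auto simp: eqv_def suq2_relations_def Let_def)

text \<open>These are the adjoints of the two relations between \<open>\<alpha>\<close> and \<open>\<gamma>, \<gamma>\<^sup>*\<close>.\<close>

lemma adjoint_relations: "c * a' \<sim>\<^sub>I const q * a' * c" "c' * a' \<sim>\<^sub>I const q * a' * c'"
proof -
  have move: "x * (y * const t) = const t * (x * y)" for x y t
    by (metis mult.assoc single_zero_times_commute)
  show "c * a' \<sim>\<^sub>I const q * a' * c" "c' * a' \<sim>\<^sub>I const q * a' * c'"
    using relations(2,3)[THEN eqv_star, THEN eqv_sym]
    by (simp_all add: poly_star_mult poly_star_single word_star_letter mult.assoc move)
qed

lemma commute_inverse:
  assumes "const q * x * a \<sim>\<^sub>I a * x" shows "x * a \<sim>\<^sub>I const (1 / q) * a * x"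
proof -
  have "const (1 / q) * (const q * x * a) = x * a"
    using q_nonzero by (simp add: const_mult flip: mult.assoc)
  then show ?thesis
    using eqv_left[OF assms, of "const (1 / q)"] by (simp add: mult.assoc)
qed

lemma commute_power:
  assumes "x * y \<sim>\<^sub>I const t * y * x" shows "x * y ^ k \<sim>\<^sub>I const (t ^ k) * y ^ k * x"
proof (induction k)
  case (Suc k)
  have "x * y ^ Suc k = (x * y) * y ^ k" by (simp add: mult.assoc)
  also have "\<dots> \<sim>\<^sub>I (const t * y * x) * y ^ k" by (rule eqv_right[OF assms])
  also have "\<dots> = (const t * y) * (x * y ^ k)" by (simp add: mult.assoc)
  also have "\<dots> \<sim>\<^sub>I (const t * y) * (const (t ^ k) * y ^ k * x)" by (rule eqv_left[OF Suc])
  also have "\<dots> = const (t ^ Suc k) * y ^ Suc k * x"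
    by (simp add: mult.assoc const_left_commute[of y] const_mult[symmetric])
  finally show ?case .
qed simp

definition a_power :: "int \<Rightarrow> suq2_generator word \<Rightarrow>\<^sub>0 complex" where
  "a_power k = (if 0 \<le> k then a ^ nat k else a' ^ nat (- k))"

lemma gamma_a_power:
  "\<exists>t. c * a_power k \<sim>\<^sub>I const t * a_power k * c"
  "\<exists>t. c' * a_power k \<sim>\<^sub>I const t * a_power k * c'"
proof -
  show "\<exists>t. c * a_power k \<sim>\<^sub>I const t * a_power k * c"
  proof (cases "0 \<le> k")
    case True
    then show ?thesis
      using commute_power[OF commute_inverse[OF relations(3)], of "nat k"] by (auto simp: a_power_def)
  next
    case False
    then show ?thesis
      using commute_power[OF adjoint_relations(1), of "nat (- k)"] by (auto simp: a_power_def)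
  qed
  show "\<exists>t. c' * a_power k \<sim>\<^sub>I const t * a_power k * c'"
  proof (cases "0 \<le> k")
    case True
    then show ?thesis
      using commute_power[OF commute_inverse[OF relations(2)], of "nat k"] by (auto simp: a_power_def)
  next
    case False
    then show ?thesis
      using commute_power[OF adjoint_relations(2), of "nat (- k)"] by (auto simp: a_power_def)
  qed
qed

definition basis :: "int \<times> nat \<times> nat \<Rightarrow> suq2_generator word \<Rightarrow>\<^sub>0 complex" where
  "basis = (\<lambda>(k, m, n). a_power k * c ^ m * c' ^ n)"

text \<open>The linear span of the monomials, taken modulo the ideal. Everything lies in it, because it contains
  1 and is closed under left multiplication by each letter.\<close>

inductive_set NF :: "(suq2_generator word \<Rightarrow>\<^sub>0 complex) set" where
  basis: "basis x \<in> NF"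
| add: "x \<in> NF \<Longrightarrow> y \<in> NF \<Longrightarrow> x + y \<in> NF"
| scale: "x \<in> NF \<Longrightarrow> const t * x \<in> NF"
| ideal: "x \<in> I \<Longrightarrow> x \<in> NF"

lemma NF_eqv: "x \<sim>\<^sub>I y \<Longrightarrow> y \<in> NF \<Longrightarrow> x \<in> NF"
  using NF.add[OF NF.ideal, of "x - y" y] by (simp add: eqv_def)

lemma NF_minus:
  assumes "x \<in> NF" "y \<in> NF" shows "x - y \<in> NF"
  using NF.add[OF assms(1) NF.scale[OF assms(2), of "- 1"]] by (simp add: single_uminus)

lemma NF_left_mult:
  assumes l: "\<And>k m n. l * basis (k, m, n) \<in> NF" and x: "x \<in> NF"
  shows "l * x \<in> NF"
  using x
proof induction
  case (basis x)
  then show ?case using l by (cases x) simp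
next
  case (scale x t)
  then show ?case using NF.scale[of "l * x" t] by (simp add: const_left_commute)
qed (simp_all add: NF.add NF.ideal I_left distrib_left)

lemma NF_gamma: "x \<in> NF \<Longrightarrow> c * x \<in> NF"
proof (rule NF_left_mult)
  fix k m n
  obtain t where t: "c * a_power k \<sim>\<^sub>I const t * a_power k * c" using gamma_a_power by blast
  have "c * basis (k, m, n) = (c * a_power k) * (c ^ m * c' ^ n)"
    by (simp add: basis_def mult.assoc)
  also have "\<dots> \<sim>\<^sub>I (const t * a_power k * c) * (c ^ m * c' ^ n)" by (rule eqv_right[OF t])
  also have "\<dots> = const t * basis (k, Suc m, n)"
    by (simp add: basis_def mult.assoc)
  finally show "c * basis (k, m, n) \<in> NF" by (rule NF_eqv) (intro NF.scale NF.basis)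
qed

lemma NF_gamma_star: "x \<in> NF \<Longrightarrow> c' * x \<in> NF"
proof (rule NF_left_mult)
  fix k m n
  obtain t where t: "c' * a_power k \<sim>\<^sub>I const t * a_power k * c'" using gamma_a_power by blast
  have comm: "c' * c ^ m \<sim>\<^sub>I c ^ m * c'"
    using commute_power[of c' c 1 m] relations(1) by simp
  have "c' * basis (k, m, n) = (c' * a_power k) * (c ^ m * c' ^ n)"
    by (simp add: basis_def mult.assoc)
  also have "\<dots> \<sim>\<^sub>I (const t * a_power k * c') * (c ^ m * c' ^ n)" by (rule eqv_right[OF t])
  also have "\<dots> = (const t * a_power k) * ((c' * c ^ m) * c' ^ n)" by (simp add: mult.assoc)
  also have "\<dots> \<sim>\<^sub>I (const t * a_power k) * ((c ^ m * c') * c' ^ n)"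
    by (intro eqv_left eqv_right comm)
  also have "\<dots> = const t * basis (k, m, Suc n)"
    by (simp add: basis_def mult.assoc)
  finally show "c' * basis (k, m, n) \<in> NF" by (rule NF_eqv) (intro NF.scale NF.basis)
qed

text \<open>For \<open>k < 0\<close> the letter \<open>\<alpha>\<close> meets a factor \<open>\<alpha>\<^sup>*\<close>, and \<open>\<alpha> \<alpha>\<^sup>* = 1 - q\<^sup>2 \<gamma> \<gamma>\<^sup>*\<close> reduces the claim to left
  multiplication by \<open>\<gamma>\<close> and \<open>\<gamma>\<^sup>*\<close>.\<close>

lemma NF_alpha: "x \<in> NF \<Longrightarrow> a * x \<in> NF"
proof (rule NF_left_mult)
  fix k m n
  show "a * basis (k, m, n) \<in> NF"
  proof (cases "0 \<le> k")
    case True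
    then have "a * basis (k, m, n) = basis (k + 1, m, n)"
      by (simp add: basis_def a_power_def nat_add_distrib mult.assoc)
    then show ?thesis using NF.basis by simp
  next
    case False
    then have "nat (- k) = Suc (nat (- (k + 1)))" by simp
    then have "a_power k = a' * a_power (k + 1)"
      using False by (simp add: a_power_def)
    then have "a * basis (k, m, n) = (a * a') * basis (k + 1, m, n)"
      by (simp add: basis_def mult.assoc)
    moreover have "a * a' \<sim>\<^sub>I 1 - const (q\<^sup>2) * c * c'"
      using relations(5) by (simp add: eqv_def algebra_simps)
    ultimately have "a * basis (k, m, n) \<sim>\<^sub>I (1 - const (q\<^sup>2) * c * c') * basis (k + 1, m, n)"
      using eqv_right by metis
    also have "\<dots> = basis (k + 1, m, n) - const (q\<^sup>2) * (c * (c' * basis (k + 1, m, n)))"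
      by (simp add: left_diff_distrib mult.assoc)
    finally show ?thesis
      by (rule NF_eqv) (intro NF_minus NF.scale NF_gamma NF_gamma_star NF.basis)
  qed
qed

lemma NF_alpha_star: "x \<in> NF \<Longrightarrow> a' * x \<in> NF"
proof (rule NF_left_mult)
  fix k m n
  show "a' * basis (k, m, n) \<in> NF"
  proof (cases "k \<le> 0")
    case True
    have "nat (- (k - 1)) = Suc (nat (- k))" using True by simp
    then have "a_power (k - 1) = a' * a_power k"
      using True by (cases "k = 0") (simp_all add: a_power_def)
    then have "a' * basis (k, m, n) = basis (k - 1, m, n)"
      by (simp add: basis_def mult.assoc)
    then show ?thesis using NF.basis by simp
  next
    case False
    then have "nat k = Suc (nat (k - 1))" by simp
    then have "a_power k = a * a_power (k - 1)"
      using False by (simp add: a_power_def)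
    then have "a' * basis (k, m, n) = (a' * a) * basis (k - 1, m, n)"
      by (simp add: basis_def mult.assoc)
    moreover have "a' * a \<sim>\<^sub>I 1 - c' * c"
      using relations(4) by (simp add: eqv_def algebra_simps)
    ultimately have "a' * basis (k, m, n) \<sim>\<^sub>I (1 - c' * c) * basis (k - 1, m, n)"
      using eqv_right by metis
    also have "\<dots> = basis (k - 1, m, n) - c' * (c * basis (k - 1, m, n))"
      by (simp add: left_diff_distrib mult.assoc)
    finally show ?thesis
      by (rule NF_eqv) (intro NF_minus NF_gamma NF_gamma_star NF.basis)
  qed
qed

lemma in_NF: "p \<in> NF"
proof (induction p rule: poly_mapping_induct)
  case (single w t)
  have "Poly_Mapping.single w 1 \<in> NF"
  proof (induction w rule: word_induct)
    case zero
    have "Poly_Mapping.single 0 1 = basis (0, 0, 0)" by (simp add: basis_def a_power_def)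
    then show ?case using NF.basis[of "(0, 0, 0)"] by simp
  next
    case (Cons l w)
    have "Poly_Mapping.single (Word [l] + w) 1 = letter l * Poly_Mapping.single w 1"
      by (simp add: mult_single)
    then show ?case
      using NF_alpha[OF Cons] NF_alpha_star[OF Cons] NF_gamma[OF Cons] NF_gamma_star[OF Cons]
      by (cases l rule: suq2_letter_cases) simp_all
  qed
  from NF.scale[OF this, of t] show ?case by (simp add: mult_single)
qed (rule NF.add)

text \<open>With coefficients that vanish outside \<open>F\<close>, two combinations can be added over the union of their
  index sets.\<close>

lemma normal_form:
  "\<exists>F f. finite F \<and> (\<forall>x. x \<notin> F \<longrightarrow> f x = 0) \<and> p \<sim>\<^sub>I (\<Sum>x\<in>F. const (f x) * basis x)"
  using in_NF[of p]
proof induction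
  case (basis x)
  show ?case by (rule exI[of _ "{x}"], rule exI[of _ "\<lambda>y. if y = x then 1 else 0"]) auto
next
  case (add x y)
  then obtain F f G g where F: "finite F" "\<forall>x. x \<notin> F \<longrightarrow> f x = 0" "x \<sim>\<^sub>I (\<Sum>x\<in>F. const (f x) * basis x)"
    and G: "finite G" "\<forall>x. x \<notin> G \<longrightarrow> g x = 0" "y \<sim>\<^sub>I (\<Sum>x\<in>G. const (g x) * basis x)"
    by blast
  have "(\<Sum>x\<in>F. const (f x) * basis x) = (\<Sum>x\<in>F \<union> G. const (f x) * basis x)"
    using F G by (intro sum.mono_neutral_left) auto
  moreover have "(\<Sum>x\<in>G. const (g x) * basis x) = (\<Sum>x\<in>F \<union> G. const (g x) * basis x)"
    using F G by (intro sum.mono_neutral_left) auto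
  ultimately have "(\<Sum>x\<in>F \<union> G. const (f x + g x) * basis x)
      = (\<Sum>x\<in>F. const (f x) * basis x) + (\<Sum>x\<in>G. const (g x) * basis x)"
    by (simp add: single_add distrib_right sum.distrib)
  then have "x + y \<sim>\<^sub>I (\<Sum>x\<in>F \<union> G. const (f x + g x) * basis x)"
    using I_add[OF F(3)[unfolded eqv_def] G(3)[unfolded eqv_def]]
    by (simp add: eqv_def algebra_simps)
  then show ?case
    using F(1,2) G(1,2) by (intro exI[of _ "F \<union> G"] exI[of _ "\<lambda>x. f x + g x"]) auto
next
  case (scale x t)
  then obtain F f where F: "finite F" "\<forall>x. x \<notin> F \<longrightarrow> f x = 0" "x \<sim>\<^sub>I (\<Sum>x\<in>F. const (f x) * basis x)"
    by blast
  have "const t * (\<Sum>x\<in>F. const (f x) * basis x) = (\<Sum>x\<in>F. const (t * f x) * basis x)"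
    by (simp add: sum_distrib_left flip: const_mult mult.assoc)
  then have "const t * x \<sim>\<^sub>I (\<Sum>x\<in>F. const (t * f x) * basis x)"
    using eqv_left[OF F(3), of "const t"] by simp
  then show ?case
    using F(1,2) by (intro exI[of _ F] exI[of _ "\<lambda>x. t * f x"]) auto
next
  case (ideal x)
  then have "x \<sim>\<^sub>I (\<Sum>x\<in>{}. const 0 * basis x)" by (simp add: eqv_def)
  then show ?case by (intro exI[of _ "{}"] exI[of _ "\<lambda>_. 0"]) auto
qed

end

section \<open>Representations of \<open>Pol(SU\<^sub>q(2))\<close> by weighted shifts\<close>

lift_definition diag :: "('i \<Rightarrow> complex) \<Rightarrow> 'i finsupp \<Rightarrow> 'i finsupp" is "\<lambda>d f x. d x * f x"
  by (rule finite_subset[rotated]) auto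

lift_definition shift_down :: "(nat \<Rightarrow> real) \<Rightarrow> ('i \<times> nat) finsupp \<Rightarrow> ('i \<times> nat) finsupp"
  is "\<lambda>s f (i, j). complex_of_real (s (Suc j)) * f (i, Suc j)"
proof -
  fix s :: "nat \<Rightarrow> real" and f :: "'i \<times> nat \<Rightarrow> complex" assume f: "finite {x. f x \<noteq> 0}"
  have "{x. (case x of (i, j) \<Rightarrow> complex_of_real (s (Suc j)) * f (i, Suc j)) \<noteq> 0}
      \<subseteq> (\<lambda>(i, j). (i, j - 1)) ` {x. f x \<noteq> 0}"
    by (force simp: image_iff)
  then show "finite {x. (case x of (i, j) \<Rightarrow> complex_of_real (s (Suc j)) * f (i, Suc j)) \<noteq> 0}"
    using f finite_surj by blast
qed

lift_definition shift_up :: "(nat \<Rightarrow> real) \<Rightarrow> ('i \<times> nat) finsupp \<Rightarrow> ('i \<times> nat) finsupp"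
  is "\<lambda>s f (i, j). case j of 0 \<Rightarrow> 0 | Suc k \<Rightarrow> complex_of_real (s j) * f (i, k)"
proof -
  fix s :: "nat \<Rightarrow> real" and f :: "'i \<times> nat \<Rightarrow> complex" assume f: "finite {x. f x \<noteq> 0}"
  have "{x. (case x of (i, j) \<Rightarrow> case j of 0 \<Rightarrow> 0 | Suc k \<Rightarrow> complex_of_real (s j) * f (i, k)) \<noteq> 0}
      \<subseteq> (\<lambda>(i, j). (i, Suc j)) ` {x. f x \<noteq> 0}"
    by (force simp: image_iff split: nat.splits)
  then show "finite {x. (case x of (i, j) \<Rightarrow> case j of 0 \<Rightarrow> 0 | Suc k \<Rightarrow> complex_of_real (s j) * f (i, k)) \<noteq> 0}"
    using f finite_surj by blast
qed

lemma entry_diag [simp]: "entry (diag d v) x = d x * entry v x"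
  by (simp add: diag.rep_eq)

lemma entry_shift [simp]:
  "entry (shift_down s v) (i, j) = s (Suc j) * entry v (i, Suc j)"
  "entry (shift_up s v) (i, 0) = 0"
  "entry (shift_up s v) (i, Suc j) = s (Suc j) * entry v (i, j)"
  by (simp_all add: shift_down.rep_eq shift_up.rep_eq)

lemma diag_adjoint: "inner (diag d v) w = inner v (diag (\<lambda>x. cnj (d x)) w)"
proof -
  have "inner (d x * a) b = inner a (cnj (d x) * b)" for x a b
    by (simp add: inner_complex_def algebra_simps)
  moreover have "inner (diag d v) w = (\<Sum>x | entry v x \<noteq> 0. inner (entry (diag d v) x) (entry w x))"
    by (rule inner_finsupp_superset) auto
  ultimately show ?thesis by (simp add: inner_finsupp_def)
qed

text \<open>Substitute \<open>(i, j + 1)\<close> for \<open>(i, j)\<close> in the sum; the boundary terms at \<open>j = 0\<close> vanish.\<close>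

lemma shift_adjoint: "inner (shift_down s v) w = inner v (shift_up s w)"
proof -
  let ?F = "{x. entry w x \<noteq> 0}"
  let ?h = "\<lambda>(i, j). (i, Suc j)"
  have "inner (entry (shift_down s v) x) (entry w x)
      = inner (entry v (?h x)) (entry (shift_up s w) (?h x))" for x
    by (cases x) (simp add: inner_complex_def algebra_simps)
  then have "inner (shift_down s v) w
      = (\<Sum>x\<in>?F. inner (entry v (?h x)) (entry (shift_up s w) (?h x)))"
    by (simp add: inner_finsupp_swap)
  also have "\<dots> = (\<Sum>x\<in>?h ` ?F. inner (entry v x) (entry (shift_up s w) x))"
    by (subst sum.reindex) (auto simp: inj_on_def)
  also have "\<dots> = (\<Sum>x\<in>?h ` ?F. inner (entry (shift_up s w) x) (entry v x))"
    by (simp add: inner_commute)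
  also have "\<dots> = inner (shift_up s w) v"
  proof (rule inner_finsupp_superset[symmetric])
    show "{x. entry (shift_up s w) x \<noteq> 0} \<subseteq> ?h ` ?F"
    proof
      fix x assume "x \<in> {x. entry (shift_up s w) x \<noteq> 0}"
      then show "x \<in> ?h ` ?F" by (cases x; cases "snd x") (auto simp: image_iff)
    qed
  qed simp
  finally show ?thesis by (simp add: inner_commute)
qed

lemma norm_diag_le:
  assumes "\<And>x. cmod (d x) \<le> K"
  shows "norm (diag d v) \<le> K * norm v"
proof -
  have "0 \<le> K" using assms[of undefined] norm_ge_zero order_trans by blast
  have "(norm (diag d v))\<^sup>2 = (\<Sum>x | entry v x \<noteq> 0. (cmod (entry (diag d v) x))\<^sup>2)"
    unfolding power2_norm_eq_inner
    by (subst inner_finsupp_superset[of "{x. entry v x \<noteq> 0}"]) auto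
  also have "\<dots> \<le> (\<Sum>x | entry v x \<noteq> 0. K\<^sup>2 * (cmod (entry v x))\<^sup>2)"
    using assms \<open>0 \<le> K\<close>
    by (intro sum_mono) (simp add: norm_mult power_mult_distrib mult_right_mono power_mono)
  also have "\<dots> = (K * norm v)\<^sup>2"
    by (simp add: norm_finsupp_eq power_mult_distrib sum_nonneg flip: sum_distrib_left)
  finally show ?thesis
    by (rule power2_le_imp_le) (simp add: \<open>0 \<le> K\<close>)
qed

definition weight :: "real \<Rightarrow> nat \<Rightarrow> real" where "weight q j = sqrt (1 - q ^ (2 * j))"

fun suq2_op :: "real \<Rightarrow> ('i \<Rightarrow> complex) \<Rightarrow> suq2_generator letter \<Rightarrow> ('i \<times> nat) finsupp \<Rightarrow> ('i \<times> nat) finsupp"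
  where
    "suq2_op q \<sigma> (Gen Alpha) = shift_down (weight q)"
  | "suq2_op q \<sigma> (Adj Alpha) = shift_up (weight q)"
  | "suq2_op q \<sigma> (Gen Gamma) = diag (\<lambda>(i, j). \<sigma> i * q ^ j)"
  | "suq2_op q \<sigma> (Adj Gamma) = diag (\<lambda>(i, j). cnj (\<sigma> i) * q ^ j)"

text \<open>The first coordinate of a basis index selects the summand with parameter \<open>\<sigma> i\<close>, the second one is
  the position in it.\<close>

locale suq2_representation =
  fixes q :: real and \<sigma> :: "nat \<Rightarrow> complex"
  assumes q: "q \<noteq> 0" "\<bar>q\<bar> < 1"
    and norm_\<sigma>: "\<And>i. cmod (\<sigma> i) = 1"
    and inj_\<sigma>: "inj \<sigma>"
begin

abbreviation "T \<equiv> suq2_op q \<sigma>"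

lemma \<sigma>_cnj: "\<sigma> i * cnj (\<sigma> i) = 1"
  using norm_\<sigma>[of i] complex_norm_square[of "\<sigma> i"] by simp

lemma q_power_le_1: "q ^ (2 * j) \<le> 1"
  using q by (simp add: power_mult abs_square_le_1 power_le_one)

lemma weight_square: "complex_of_real (weight q j) * complex_of_real (weight q j) = 1 - complex_of_real q ^ (2 * j)"
proof -
  have "weight q j * weight q j = 1 - q ^ (2 * j)"
    using q_power_le_1 by (simp add: weight_def)
  then have "complex_of_real (weight q j * weight q j) = complex_of_real (1 - q ^ (2 * j))"
    by simp
  then show ?thesis by simp
qed

lemma weight_Suc_nonzero: "weight q (Suc j) \<noteq> 0"
proof -
  have "q\<^sup>2 < 1" using q by (simp add: abs_square_less_1)
  then have "(q\<^sup>2) ^ Suc j < 1" by (intro power_Suc_less_one) (use q in auto)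
  then show ?thesis by (simp only: weight_def power_mult) simp
qed

lemma op_relations:
  "T (Adj Gamma) (T (Gen Gamma) v) = T (Gen Gamma) (T (Adj Gamma) v)"
  "scaleC q (T (Adj Gamma) (T (Gen Alpha) v)) = T (Gen Alpha) (T (Adj Gamma) v)"
  "scaleC q (T (Gen Gamma) (T (Gen Alpha) v)) = T (Gen Alpha) (T (Gen Gamma) v)"
  "T (Adj Alpha) (T (Gen Alpha) v) + T (Adj Gamma) (T (Gen Gamma) v) = v"
  "T (Gen Alpha) (T (Adj Alpha) v) + scaleC (q\<^sup>2) (T (Gen Gamma) (T (Adj Gamma) v)) = v"
proof -
  have w: "complex_of_real (weight q j) * (complex_of_real (weight q j) * x) = (1 - complex_of_real q ^ (2 * j)) * x" for j x
    by (simp add: weight_square flip: mult.assoc)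
  show comm: "T (Adj Gamma) (T (Gen Gamma) v) = T (Gen Gamma) (T (Adj Gamma) v)"
    by (auto intro!: finsupp_eqI)
  show "scaleC q (T (Adj Gamma) (T (Gen Alpha) v)) = T (Gen Alpha) (T (Adj Gamma) v)"
    "scaleC q (T (Gen Gamma) (T (Gen Alpha) v)) = T (Gen Alpha) (T (Gen Gamma) v)"
    by (auto intro!: finsupp_eqI)
  have down_up: "entry (T (Gen Alpha) (T (Adj Alpha) v)) (i, j) = (1 - q ^ (2 * Suc j)) * entry v (i, j)" for i j
    using w[of "Suc j" "entry v (i, j)"] by simp
  have up_down: "entry (T (Adj Alpha) (T (Gen Alpha) v)) (i, j) = (1 - q ^ (2 * j)) * entry v (i, j)" for i j
    using w[of j "entry v (i, j)"] by (cases j) simp_all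
  have diag: "entry (T (Gen Gamma) (T (Adj Gamma) v)) (i, j) = q ^ (2 * j) * entry v (i, j)" for i j
  proof -
    have "entry (T (Gen Gamma) (T (Adj Gamma) v)) (i, j)
        = (\<sigma> i * cnj (\<sigma> i)) * (q ^ j * q ^ j) * entry v (i, j)"
      by (simp add: mult_ac)
    then show ?thesis by (simp add: \<sigma>_cnj mult_2 power_add)
  qed
  show "T (Adj Alpha) (T (Gen Alpha) v) + T (Adj Gamma) (T (Gen Gamma) v) = v"
  proof (rule finsupp_eqI)
    fix x
    show "entry (T (Adj Alpha) (T (Gen Alpha) v) + T (Adj Gamma) (T (Gen Gamma) v)) x = entry v x"
      unfolding comm plus_finsupp.rep_eq
      by (cases x) (simp only: up_down diag, simp add: left_diff_distrib)
  qed
  show "T (Gen Alpha) (T (Adj Alpha) v) + scaleC (q\<^sup>2) (T (Gen Gamma) (T (Adj Gamma) v)) = v"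
  proof (rule finsupp_eqI)
    fix x
    show "entry (T (Gen Alpha) (T (Adj Alpha) v) + scaleC (q\<^sup>2) (T (Gen Gamma) (T (Adj Gamma) v))) x = entry v x"
      unfolding plus_finsupp.rep_eq entry_scaleC
      by (cases x) (simp only: down_up diag, simp add: left_diff_distrib power2_eq_square)
  qed
qed

lemma T_adjoint: "inner (T l v) w = inner v (T (letter_star l) w)"
proof (cases l)
  case (Gen g)
  then show ?thesis
    by (cases g) (simp_all add: shift_adjoint diag_adjoint split_def)
next
  case (Adj g)
  have "inner (shift_up (weight q) v) w = inner v (shift_down (weight q) w)"
    using shift_adjoint[of "weight q" w v] by (simp add: inner_commute)
  then show ?thesis
    using Adj by (cases g) (simp_all add: diag_adjoint split_def)
qed

text \<open>The relations \<open>\<alpha>\<^sup>* \<alpha> + \<gamma>\<^sup>* \<gamma> = 1\<close> and \<open>\<alpha> \<alpha>\<^sup>* + q\<^sup>2 \<gamma> \<gamma>\<^sup>* = 1\<close> make all generators contractions, e.g.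
  \<open>\<parallel>\<alpha> v\<parallel>\<^sup>2 + \<parallel>\<gamma> v\<parallel>\<^sup>2 = \<parallel>v\<parallel>\<^sup>2\<close>.\<close>

lemma norm_T_le: "norm (T l v) \<le> norm v"
proof -
  have sq: "(norm (T l v))\<^sup>2 = inner v (T (letter_star l) (T l v))" for l v
    by (simp add: power2_norm_eq_inner T_adjoint)
  have "(norm (T (Gen Alpha) v))\<^sup>2 + (norm (T (Gen Gamma) v))\<^sup>2 = (norm v)\<^sup>2"
    using op_relations(4)[of v] by (simp only: sq letter_star.simps power2_norm_eq_inner[of v] flip: inner_add_right)
  moreover have "(norm (T (Adj Alpha) v))\<^sup>2 + q\<^sup>2 * (norm (T (Adj Gamma) v))\<^sup>2 = (norm v)\<^sup>2"
  proof -
    interpret complex_inner "scaleC :: complex \<Rightarrow> (nat \<times> nat) finsupp \<Rightarrow> _" by (rule complex_inner_finsupp)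
    show ?thesis
      using op_relations(5)[of v] scaleC_of_real[of "q\<^sup>2"]
      by (simp only: sq letter_star.simps power2_norm_eq_inner[of v] flip: inner_add_right inner_scaleR_right)
  qed
  moreover have "(norm (T (Adj Gamma) v))\<^sup>2 = (norm (T (Gen Gamma) v))\<^sup>2"
    by (simp only: sq letter_star.simps op_relations(1))
  ultimately have "(norm (T l v))\<^sup>2 \<le> (norm v)\<^sup>2"
    using zero_le_power2[of "norm (T (Gen Alpha) v)"] zero_le_power2[of "norm (T (Gen Gamma) v)"]
      mult_nonneg_nonneg[OF zero_le_power2[of q] zero_le_power2[of "norm (T (Adj Gamma) v)"]]
    by (cases l rule: suq2_letter_cases; hypsubst) linarith+
  then show ?thesis by (rule power2_le_imp_le) simp
qed

sublocale rep: letter_representation scaleC T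
proof (intro letter_representation.intro letter_representation_axioms.intro complex_inner_finsupp)
  fix l c and v w :: "(nat \<times> nat) finsupp"
  show "inner (T l v) w = inner v (T (letter_star l) w)" by (rule T_adjoint)
  have all: "P (Gen Alpha) \<Longrightarrow> P (Adj Alpha) \<Longrightarrow> P (Gen Gamma) \<Longrightarrow> P (Adj Gamma) \<Longrightarrow> P l" for P
    by (cases l rule: suq2_letter_cases) simp_all
  have up: "entry (shift_up s v) (i, j) = (case j of 0 \<Rightarrow> 0 | Suc k \<Rightarrow> s j * entry v (i, k))" for s v and i j :: nat
    by (simp split: nat.split)
  have add: "T l (v + w) = T l v + T l w" for v w
    by (rule all) (auto intro!: finsupp_eqI simp: algebra_simps up split: nat.split)
  show scaleC: "T l (scaleC c v) = scaleC c (T l v)" for c v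
    by (rule all) (auto intro!: finsupp_eqI simp: algebra_simps up split: nat.split)
  have "T l (r *\<^sub>R v) = r *\<^sub>R T l v" for r v
    using scaleC[of "complex_of_real r" v] complex_inner.scaleC_of_real[OF complex_inner_finsupp] by metis
  then show "bounded_linear (T l)"
    using norm_T_le by (intro bounded_linear_intro[of _ 1]) (auto simp: add)
qed

lemma rep_letter [simp]: "rep.rep (letter l) v = T l v"
  by (simp add: rep.rep_single rep.scaleC_one)

lemma rep_const [simp]: "rep.rep (const t) v = scaleC t v"
  by (simp add: rep.rep_single)

lemma rep_relations:
  assumes "r \<in> suq2_relations q" shows "rep.rep r v = 0"
proof -
  show ?thesis
    using assms op_relations[of v]
    by (auto simp: suq2_relations_def Let_def rep.rep_minus rep.rep_add rep.rep_mult rep.rep_one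
        simp del: suq2_op.simps)
qed

sublocale suq2_ideal q "generated_star_ideal free_star_algebra (suq2_relations q)"
  by unfold_locales (use q in auto)

end

section \<open>Faithfulness of the representations\<close>

lemma poly_eq_0_if_zeros:
  fixes p :: "complex poly"
  assumes "infinite S" "\<And>x. x \<in> S \<Longrightarrow> poly p x = 0"
  shows "p = 0"
  using assms poly_roots_finite[of p] by (metis (mono_tags, lifting) finite_subset mem_Collect_eq subsetI)

text \<open>The left-hand side is the coefficient of degree \<open>d\<close> of a polynomial with infinitely many zeros.\<close>

lemma coeff_monom_sum_eq_0:
  fixes h :: "'b \<Rightarrow> complex"
  assumes G: "finite G" and S: "infinite S" "\<And>x. x \<in> S \<Longrightarrow> (\<Sum>y\<in>G. h y * x ^ e y) = 0"
  shows "(\<Sum>y\<in>{y \<in> G. e y = d}. h y) = 0"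
proof -
  define P where "P = (\<Sum>y\<in>G. monom (h y) (e y))"
  have "P = 0"
    by (rule poly_eq_0_if_zeros[OF S(1)]) (simp add: P_def poly_sum poly_monom S(2))
  then have "coeff P d = 0" by simp
  then have "(\<Sum>y\<in>G. if e y = d then h y else 0) = 0"
    by (simp add: P_def Polynomial.coeff_sum)
  then show ?thesis using G by (simp add: sum.inter_filter)
qed

context suq2_representation
begin

lemma inj_q_power: "inj (\<lambda>j. complex_of_real q ^ j)"
proof -
  have "j = k" if "complex_of_real q ^ j = complex_of_real q ^ k" for j k
  proof -
    have "\<bar>q\<bar> ^ j = \<bar>q\<bar> ^ k"
      using arg_cong[OF that, of cmod] by (simp add: norm_power)
    then show ?thesis
      using q by (metis less_irrefl linorder_neqE_nat power_strict_decreasing zero_less_abs_iff)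
  qed
  then show ?thesis by (auto simp: inj_def)
qed

text \<open>On the points \<open>\<sigma>\<^sub>i q\<^sup>j\<close> the sum is a polynomial in \<open>q\<^sup>j\<close>, in which \<open>z\<^sup>m (z\<^sup>*)\<^sup>n\<close> has degree \<open>m + n\<close>. Its
  homogeneous part of degree \<open>d = m + n\<close> becomes, after multiplication by \<open>\<sigma>\<^sub>i\<^sup>d\<close>, a polynomial in \<open>\<sigma>\<^sub>i\<close>,
  in which the exponent \<open>2 m\<close> determines \<open>m\<close> and hence the pair \<open>(m, n)\<close>.\<close>

lemma monomials_independent:
  assumes G: "finite G" and y: "y \<in> G"
    and zero: "\<And>i j. j \<ge> J \<Longrightarrow>
      (\<Sum>(m, n)\<in>G. g (m, n) * ((\<sigma> i * q ^ j) ^ m * (cnj (\<sigma> i) * q ^ j) ^ n)) = 0"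
  shows "g y = 0"
proof -
  obtain m0 n0 where y': "y = (m0, n0)" by (cases y)
  define e where "e = (\<lambda>(m, n). m + n :: nat)"
  define H where "H = {x \<in> G. e x = m0 + n0}"
  have "(\<Sum>x\<in>H. g x * (\<sigma> i ^ fst x * cnj (\<sigma> i) ^ snd x)) = 0" for i
    unfolding H_def
  proof (rule coeff_monom_sum_eq_0[OF G])
    show "infinite ((\<lambda>j. complex_of_real q ^ j) ` {J..})"
      using inj_q_power by (simp add: finite_image_iff inj_on_subset infinite_Ici)
    fix x assume "x \<in> (\<lambda>j. complex_of_real q ^ j) ` {J..}"
    then obtain j where j: "j \<ge> J" "x = complex_of_real q ^ j" by auto
    show "(\<Sum>y\<in>G. g y * (\<sigma> i ^ fst y * cnj (\<sigma> i) ^ snd y) * x ^ e y) = 0"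
      using zero[OF j(1), of i]
      by (simp add: j(2) e_def split_def power_mult_distrib power_add mult_ac)
  qed
  moreover have "\<sigma> i ^ (m0 + n0) * (\<sigma> i ^ fst x * cnj (\<sigma> i) ^ snd x) = \<sigma> i ^ (2 * fst x)"
    if "x \<in> H" for i x
  proof -
    have "m0 + n0 = fst x + snd x" using that by (simp add: H_def e_def split_def)
    then have "\<sigma> i ^ (m0 + n0) * (\<sigma> i ^ fst x * cnj (\<sigma> i) ^ snd x)
        = \<sigma> i ^ fst x * \<sigma> i ^ fst x * (\<sigma> i * cnj (\<sigma> i)) ^ snd x"
      by (simp add: power_add power_mult_distrib mult_ac)
    then show ?thesis by (simp add: \<sigma>_cnj mult_2 power_add)
  qed
  ultimately have "(\<Sum>x\<in>H. g x * \<sigma> i ^ (2 * fst x)) = 0" for i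
  proof -
    assume *: "\<And>i. (\<Sum>x\<in>H. g x * (\<sigma> i ^ fst x * cnj (\<sigma> i) ^ snd x)) = 0"
      and **: "\<And>x i. x \<in> H \<Longrightarrow>
        \<sigma> i ^ (m0 + n0) * (\<sigma> i ^ fst x * cnj (\<sigma> i) ^ snd x) = \<sigma> i ^ (2 * fst x)"
    have "(\<Sum>x\<in>H. g x * \<sigma> i ^ (2 * fst x))
        = (\<Sum>x\<in>H. \<sigma> i ^ (m0 + n0) * (g x * (\<sigma> i ^ fst x * cnj (\<sigma> i) ^ snd x)))"
    proof (rule sum.cong[OF refl])
      fix x assume "x \<in> H"
      show "g x * \<sigma> i ^ (2 * fst x) = \<sigma> i ^ (m0 + n0) * (g x * (\<sigma> i ^ fst x * cnj (\<sigma> i) ^ snd x))"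
        unfolding **[OF \<open>x \<in> H\<close>, symmetric] by (rule mult.left_commute)
    qed
    then show ?thesis using *[of i] by (simp flip: sum_distrib_left)
  qed
  then have "(\<Sum>x\<in>{x \<in> H. 2 * fst x = 2 * m0}. g x) = 0"
    using inj_\<sigma> G
    by (intro coeff_monom_sum_eq_0[where S = "range \<sigma>"]) (auto simp: H_def finite_image_iff)
  moreover have "{x \<in> H. 2 * fst x = 2 * m0} = {y}"
    using y by (auto simp: H_def e_def y')
  ultimately show ?thesis by simp
qed

lemma T_gamma_unit_vec:
  "T (Gen Gamma) (unit_vec (i, j)) = scaleC (\<sigma> i * q ^ j) (unit_vec (i, j))"
  "T (Adj Gamma) (unit_vec (i, j)) = scaleC (cnj (\<sigma> i) * q ^ j) (unit_vec (i, j))"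
  by (auto intro!: finsupp_eqI)

lemma T_alpha_unit_vec:
  "T (Gen Alpha) (unit_vec (i, Suc j)) = scaleC (weight q (Suc j)) (unit_vec (i, j))"
  "T (Adj Alpha) (unit_vec (i, j)) = scaleC (weight q (Suc j)) (unit_vec (i, Suc j))"
proof -
  show "T (Gen Alpha) (unit_vec (i, Suc j)) = scaleC (weight q (Suc j)) (unit_vec (i, j))"
    by (auto intro!: finsupp_eqI)
  show "T (Adj Alpha) (unit_vec (i, j)) = scaleC (weight q (Suc j)) (unit_vec (i, Suc j))"
  proof (rule finsupp_eqI)
    fix x :: "nat \<times> nat"
    show "entry (T (Adj Alpha) (unit_vec (i, j))) x
        = entry (scaleC (weight q (Suc j)) (unit_vec (i, Suc j))) x"
      by (cases x; cases "snd x") auto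
  qed
qed

lemma rep_eigen_power:
  assumes "rep.rep p v = scaleC z v" shows "rep.rep (p ^ n) v = scaleC (z ^ n) v"
proof (induction n)
  case (Suc n)
  have "rep.rep (p ^ Suc n) v = rep.rep (p ^ n) (rep.rep p v)"
    by (simp only: power_Suc2 rep.rep_mult)
  also have "\<dots> = rep.rep (p ^ n) (rep.rep (const z) v)"
    by (simp add: assms)
  also have "\<dots> = rep.rep (const z) (rep.rep (p ^ n) v)"
    by (simp only: single_zero_times_commute flip: rep.rep_mult)
  finally show ?case by (simp add: Suc rep.scaleC_scaleC)
qed (simp add: rep.rep_one rep.scaleC_one)

lemma rep_scaleC: "rep.rep p (scaleC t v) = scaleC t (rep.rep p v)"
  using rep.rep_mult[of p "const t" v] rep.rep_mult[of "const t" p v]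
    single_zero_times_commute[of t p] by simp

lemma rep_gamma_monomial:
  "rep.rep (c ^ m * c' ^ n) (unit_vec (i, j))
    = scaleC ((\<sigma> i * q ^ j) ^ m * (cnj (\<sigma> i) * q ^ j) ^ n) (unit_vec (i, j))"
proof -
  have "rep.rep (c' ^ n) (unit_vec (i, j)) = scaleC ((cnj (\<sigma> i) * q ^ j) ^ n) (unit_vec (i, j))"
    "rep.rep (c ^ m) (unit_vec (i, j)) = scaleC ((\<sigma> i * q ^ j) ^ m) (unit_vec (i, j))"
    by (rule rep_eigen_power, simp only: rep_letter T_gamma_unit_vec)+
  then show ?thesis
    by (simp only: rep.rep_mult rep_scaleC rep.scaleC_scaleC mult.commute)
qed

text \<open>The bound on \<open>k\<close> keeps the shift from pushing the basis vector out at \<open>j = 0\<close>; the weights which it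
  collects are all nonzero.\<close>

lemma rep_a_power_unit_vec:
  assumes "k \<le> int j"
  shows "\<exists>w. w \<noteq> 0 \<and> rep.rep (a_power k) (unit_vec (i, j)) = scaleC w (unit_vec (i, nat (int j - k)))"
proof (cases "0 \<le> k")
  case True
  have down: "\<exists>w. w \<noteq> 0 \<and> rep.rep (a ^ n) (unit_vec (i, n + l)) = scaleC w (unit_vec (i, l))" for n l
  proof (induction n)
    case 0
    show ?case by (rule exI[of _ 1]) (simp add: rep.rep_one rep.scaleC_one)
  next
    case (Suc n)
    then obtain w where w: "w \<noteq> 0" "rep.rep (a ^ n) (unit_vec (i, n + l)) = scaleC w (unit_vec (i, l))"
      by blast
    have "rep.rep (a ^ Suc n) (unit_vec (i, Suc n + l))
        = scaleC (weight q (Suc (n + l)) * w) (unit_vec (i, l))"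
      by (simp only: power_Suc2 rep.rep_mult rep_letter add_Suc T_alpha_unit_vec rep_scaleC w(2)
          rep.scaleC_scaleC)
    then show ?case using w(1) weight_Suc_nonzero
      by (intro exI[of _ "weight q (Suc (n + l)) * w"]) simp
  qed
  have "j = nat k + nat (int j - k)" using True assms by simp
  then show ?thesis
    using down[of "nat k" "nat (int j - k)"] True by (simp add: a_power_def)
next
  case False
  have up: "\<exists>w. w \<noteq> 0 \<and> rep.rep (a' ^ n) (unit_vec (i, j)) = scaleC w (unit_vec (i, j + n))" for n
  proof (induction n)
    case 0
    show ?case by (rule exI[of _ 1]) (simp add: rep.rep_one rep.scaleC_one)
  next
    case (Suc n)
    then obtain w where w: "w \<noteq> 0" "rep.rep (a' ^ n) (unit_vec (i, j)) = scaleC w (unit_vec (i, j + n))"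
      by blast
    have "rep.rep (a' ^ Suc n) (unit_vec (i, j))
        = scaleC (w * weight q (Suc (j + n))) (unit_vec (i, j + Suc n))"
      by (simp only: power_Suc rep.rep_mult w(2) rep_scaleC rep_letter add_Suc_right
          T_alpha_unit_vec rep.scaleC_scaleC)
    then show ?case using w(1) weight_Suc_nonzero
      by (intro exI[of _ "w * weight q (Suc (j + n))"]) simp
  qed
  have "nat (int j - k) = j + nat (- k)" using False by simp
  then show ?thesis using up[of "nat (- k)"] False by (simp add: a_power_def)
qed

lemma rep_faithful:
  assumes p: "\<And>v. rep.rep p v = 0"
  shows "p \<in> generated_star_ideal free_star_algebra (suq2_relations q)"
proof -
  obtain F f where F: "finite F" and p_eqv: "p - (\<Sum>x\<in>F. const (f x) * basis x)
      \<in> generated_star_ideal free_star_algebra (suq2_relations q)"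
    using normal_form[of p] unfolding eqv_def by blast
  have "rep.rep (p - (\<Sum>x\<in>F. const (f x) * basis x)) v = 0" for v
    by (rule rep.rep_eq_0_on_generated[OF rep_relations p_eqv])
  then have rep_sum: "rep.rep (\<Sum>x\<in>F. const (f x) * basis x) v = 0" for v
    using p by (simp add: rep.rep_minus)
  have rep_sum': "rep.rep (\<Sum>x\<in>F. const (f x) * basis x) v = (\<Sum>x\<in>F. scaleC (f x) (rep.rep (basis x) v))" for v
    using F by (induction F rule: finite_induct) (simp_all add: rep.rep_zero rep.rep_add rep.rep_mult)
  have entry_sum: "entry (\<Sum>x\<in>F. h x) z = (\<Sum>x\<in>F. entry (h x) z)" for h :: "_ \<Rightarrow> (nat \<times> nat) finsupp" and z
    using F by (induction F rule: finite_induct) simp_all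
  \<comment> \<open>from position J on, no power of \<open>\<alpha>\<close> in the combination annihilates a basis vector\<close>
  define J where "J = nat (Max (fst ` F))"
  have J: "k \<le> int J" if "(k, y) \<in> F" for k y
  proof -
    have "fst (k, y) \<le> Max (fst ` F)" using F that by (intro Max_ge) (auto intro: rev_image_eqI)
    then show ?thesis by (simp add: J_def)
  qed
  have "f x = 0" if "x \<in> F" for x
  proof -
    obtain k y where x: "x = (k, y)" by (cases x)
    define G where "G = {y. (k, y) \<in> F}"
    have "finite G"
      by (rule finite_subset[of _ "snd ` F"]) (use F in \<open>force simp: G_def\<close>)+
    moreover have "y \<in> G" using that by (simp add: G_def x)
    moreover have "(\<Sum>(m, n)\<in>G. f (k, m, n) * ((\<sigma> i * q ^ j) ^ m * (cnj (\<sigma> i) * q ^ j) ^ n)) = 0"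
      if "j \<ge> J" for i j
    proof -
      define Z where "Z = (\<lambda>(m, n). (\<sigma> i * q ^ j) ^ m * (cnj (\<sigma> i) * q ^ j) ^ n)"
      have "\<forall>l. \<exists>w. l \<le> int j \<longrightarrow> w \<noteq> 0 \<and>
          rep.rep (a_power l) (unit_vec (i, j)) = scaleC w (unit_vec (i, nat (int j - l)))"
        using rep_a_power_unit_vec by blast
      then obtain W where W: "\<And>l. l \<le> int j \<Longrightarrow> W l \<noteq> 0"
        "\<And>l. l \<le> int j \<Longrightarrow> rep.rep (a_power l) (unit_vec (i, j)) = scaleC (W l) (unit_vec (i, nat (int j - l)))"
        by metis
      have k: "k \<le> int j" using J[of k y] \<open>x \<in> F\<close> \<open>j \<ge> J\<close> by (simp add: x)
      \<comment> \<open>only the monomials with this \<open>k\<close> reach the position \<open>j - k\<close>\<close>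
      have basis_entry: "entry (rep.rep (basis z) (unit_vec (i, j))) (i, nat (int j - k))
          = (if fst z = k then Z (snd z) * W k else 0)" if "z \<in> F" for z
      proof -
        obtain l m n where z: "z = (l, m, n)" by (cases z)
        have l: "l \<le> int j" using J[of l "(m, n)"] \<open>z \<in> F\<close> \<open>j \<ge> J\<close> by (simp add: z)
        have "rep.rep (basis z) (unit_vec (i, j))
            = scaleC (Z (m, n) * W l) (unit_vec (i, nat (int j - l)))"
          by (simp only: z basis_def prod.case mult.assoc rep.rep_mult[of "a_power l"]
              rep_gamma_monomial rep_scaleC W(2)[OF l] rep.scaleC_scaleC Z_def)
        moreover have "nat (int j - k) = nat (int j - l) \<longleftrightarrow> l = k" using l k by auto
        ultimately show ?thesis by (auto simp: z)
      qed
      have "0 = entry (rep.rep (\<Sum>x\<in>F. const (f x) * basis x) (unit_vec (i, j))) (i, nat (int j - k))"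
        by (simp only: rep_sum zero_finsupp.rep_eq)
      also have "\<dots> = (\<Sum>z\<in>F. f z * entry (rep.rep (basis z) (unit_vec (i, j))) (i, nat (int j - k)))"
        by (simp only: rep_sum' entry_sum entry_scaleC)
      also have "\<dots> = (\<Sum>z\<in>F. if fst z = k then f z * (Z (snd z) * W k) else 0)"
        by (intro sum.cong refl) (simp add: basis_entry)
      also have "\<dots> = (\<Sum>z\<in>{z \<in> F. fst z = k}. f z * (Z (snd z) * W k))"
        using F by (simp add: sum.inter_filter)
      also have "{z \<in> F. fst z = k} = Pair k ` G" by (auto simp: G_def)
      also have "(\<Sum>z\<in>Pair k ` G. f z * (Z (snd z) * W k)) = (\<Sum>y\<in>G. f (k, y) * Z y) * W k"
        by (subst sum.reindex) (auto simp: inj_on_def sum_distrib_right mult.assoc)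
      finally have "(\<Sum>y\<in>G. f (k, y) * Z y) = 0" using W(1)[OF k] by simp
      then show ?thesis by (simp add: Z_def split_def)
    qed
    ultimately have "f (k, y) = 0"
      by (rule monomials_independent[where g = "\<lambda>y. f (k, y)"])
    then show ?thesis by (simp add: x)
  qed
  then have "(\<Sum>x\<in>F. const (f x) * basis x) = 0" by (simp add: sum.neutral)
  then show ?thesis using p_eqv by simp
qed

lemma pre_cstar_norm_Pol: "pre_cstar_norm (Pol_SUq2 q) rep.rep_norm"
  unfolding Pol_SUq2_def
  by (rule rep.pre_cstar_norm_rep_norm[OF rep_relations rep_faithful])

lemma rep_one_plus_gamma: "rep.rep (1 + c) = diag (\<lambda>(i, j). 1 + \<sigma> i * q ^ j)"
  by (rule ext, rule finsupp_eqI) (auto simp: rep.rep_add rep.rep_one algebra_simps)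

end

section \<open>Two different norms\<close>

text \<open>A sequence of distinct points of the closed right half of the unit circle which starts at 1.
  All angles lie in \<open>[0, 1]\<close>, where the cosine is nonnegative and injective.\<close>

definition arc_point :: "nat \<Rightarrow> complex" where "arc_point i = cis (1 - 1 / real (Suc i))"

lemma norm_arc_point: "cmod (arc_point i) = 1"
  by (simp add: arc_point_def)

lemma arc_point_0: "arc_point 0 = 1"
  by (simp add: arc_point_def)

lemma arc_angle: "0 \<le> 1 - 1 / real (Suc i)" "1 - 1 / real (Suc i) \<le> 1"
  by (simp_all add: divide_simps)

lemma Re_arc_point: "0 \<le> Re (arc_point i)"
proof -
  have "0 \<le> cos (1 - 1 / real (Suc i))"
    by (rule cos_ge_zero) (use arc_angle[of i] pi_ge_two in linarith)+
  then show ?thesis by (simp only: arc_point_def cis.sel)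
qed

lemma inj_arc_point: "inj arc_point"
proof (rule injI)
  fix i j assume "arc_point i = arc_point j"
  then have "cos (1 - 1 / real (Suc i)) = cos (1 - 1 / real (Suc j))"
    by (simp add: arc_point_def complex_eq_iff)
  moreover have "1 - 1 / real (Suc k) \<in> {0..pi}" for k
    using arc_angle[of k] pi_ge_two unfolding atLeastAtMost_iff by linarith
  ultimately have "1 - 1 / real (Suc i) = 1 - 1 / real (Suc j)"
    using cos_inj_pi by (metis atLeastAtMost_iff)
  then show "i = j" by (simp add: field_simps)
qed

theorem theorem3p1:
  fixes q :: real
  assumes "q \<in> {-1<..<1} - {0}"
  shows "\<not> cstar_unique (Pol_SUq2 q)"
proof
  have q: "q \<noteq> 0" "\<bar>q\<bar> < 1" using assms by auto
  interpret R: suq2_representation q arc_point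
    by unfold_locales (use q norm_arc_point inj_arc_point in auto)
  interpret L: suq2_representation q "\<lambda>i. - arc_point i"
    by unfold_locales (use q norm_arc_point inj_arc_point in \<open>auto simp: inj_def\<close>)
  let ?I = "generated_star_ideal free_star_algebra (suq2_relations q)"
  let ?x = "1 + letter (Gen Gamma) :: suq2_generator word \<Rightarrow>\<^sub>0 complex"
  let ?x' = "?I +>\<^bsub>free_star_algebra\<^esub> ?x"
  interpret I: star_ideal free_star_algebra ?I
    by (rule star_ideal_generated)
  have x': "?x' \<in> carrier (Pol_SUq2 q)"
    unfolding Pol_SUq2_def presented_star_algebra_def by (rule I.coset_in_carrier) simp
  assume "cstar_unique (Pol_SUq2 q)"
  then have "R.rep.rep_norm ?x' = L.rep.rep_norm ?x'"
    using R.pre_cstar_norm_Pol L.pre_cstar_norm_Pol x' unfolding cstar_unique_def by metis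
  then have eq: "onorm (R.rep.rep ?x) = onorm (L.rep.rep ?x)"
    by (simp only: R.rep.rep_norm_coset[OF R.rep_relations] L.rep.rep_norm_coset[OF L.rep_relations])
  have "R.rep.rep ?x (unit_vec (0, 0)) = scaleC 2 (unit_vec (0, 0))"
    unfolding R.rep_one_plus_gamma by (rule finsupp_eqI) (auto simp: arc_point_0)
  then have "2 \<le> onorm (R.rep.rep ?x)"
    using onorm[OF R.rep.bounded_rep, of ?x "unit_vec (0, 0)"] by (simp add: R.rep.norm_scaleC)
  moreover have "onorm (L.rep.rep ?x) \<le> max (sqrt 2) (1 + \<bar>q\<bar>)"
  proof (rule onorm_bound)
    fix v
    have "cmod (1 + - arc_point i * q ^ j) \<le> max (sqrt 2) (1 + \<bar>q\<bar>)" for i j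
    proof (cases j)
      case 0
      have "(cmod (1 - arc_point i))\<^sup>2 = 1 - 2 * Re (arc_point i) + (cmod (arc_point i))\<^sup>2"
        by (simp only: cmod_power2) (simp add: power2_eq_square algebra_simps)
      then have "(cmod (1 - arc_point i))\<^sup>2 \<le> 2" using Re_arc_point[of i] by (simp add: norm_arc_point)
      then have "cmod (1 - arc_point i) \<le> sqrt 2" by (rule real_le_rsqrt)
      then show ?thesis using 0 by simp
    next
      case (Suc k)
      have "cmod (1 + - arc_point i * q ^ j) \<le> 1 + \<bar>q\<bar> ^ j"
        using norm_triangle_ineq[of 1 "- arc_point i * q ^ j"]
        by (simp add: norm_mult norm_power norm_arc_point)
      also have "\<dots> \<le> 1 + \<bar>q\<bar>"
        using q Suc by (simp add: mult_left_le power_le_one)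
      finally show ?thesis by simp
    qed
    then show "norm (L.rep.rep ?x v) \<le> max (sqrt 2) (1 + \<bar>q\<bar>) * norm v"
      unfolding L.rep_one_plus_gamma by (intro norm_diag_le) (auto split: prod.split)
  qed (simp add: max_def)
  moreover have "max (sqrt 2) (1 + \<bar>q\<bar>) < 2"
    using q real_sqrt_less_mono[of 2 4] by simp
  ultimately show False using eq by linarith
qed

end
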